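(* Let $R$ be a right semiartinian right V-ring that is not a semisimple ring. Then there exists a cyclic right $R$-module $M$ that cannot be decomposed as $M=P\oplus N$ with $P$ a projective submodule and $N$ a stable submodule of $M$.
   Context: Rings are associative with unity, modules are unital. A ring $R$ is right semiartinian if every nonzero right $R$-module has a simple submodule. A ring $R$ is a right V-ring if every simple right $R$-module is injective. A module is called stable if it has no nonzero projective direct summand. *)

theory Defs
  imports "HOL-Algebra.AbelCoset"
begin

section \<open>Right modules over a not necessarily commutative ring\<close>

text \<open>
  The locale \<open>module\<close> of HOL-Algebra is restricted to commutative rings. As there, the
  multiplicative fields inherited from the record \<open>ring\<close> carry no meaning for a module.
\<close>

record ('a, 'b) rmodule = "'b ring" +
  rsmult :: "'b \<Rightarrow> 'a \<Rightarrow> 'b" (infixl \<open>\<star>\<index>\<close> 70)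

locale right_module = R?: ring R + M?: abelian_group M
  for R :: "('a, 'r) ring_scheme" (structure) and M :: "('a, 'b, 'm) rmodule_scheme" (structure) +
  assumes rsmult_closed [simp, intro]:
      "\<lbrakk>x \<in> carrier M; r \<in> carrier R\<rbrakk> \<Longrightarrow> x \<star>\<^bsub>M\<^esub> r \<in> carrier M"
    and rsmult_add_left:
      "\<lbrakk>x \<in> carrier M; y \<in> carrier M; r \<in> carrier R\<rbrakk> \<Longrightarrow>
        (x \<oplus>\<^bsub>M\<^esub> y) \<star>\<^bsub>M\<^esub> r = x \<star>\<^bsub>M\<^esub> r \<oplus>\<^bsub>M\<^esub> y \<star>\<^bsub>M\<^esub> r"
    and rsmult_add_right:
      "\<lbrakk>x \<in> carrier M; r \<in> carrier R; s \<in> carrier R\<rbrakk> \<Longrightarrow>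
        x \<star>\<^bsub>M\<^esub> (r \<oplus>\<^bsub>R\<^esub> s) = x \<star>\<^bsub>M\<^esub> r \<oplus>\<^bsub>M\<^esub> x \<star>\<^bsub>M\<^esub> s"
    and rsmult_assoc:
      "\<lbrakk>x \<in> carrier M; r \<in> carrier R; s \<in> carrier R\<rbrakk> \<Longrightarrow>
        x \<star>\<^bsub>M\<^esub> (r \<otimes>\<^bsub>R\<^esub> s) = (x \<star>\<^bsub>M\<^esub> r) \<star>\<^bsub>M\<^esub> s"
    and rsmult_one [simp]:
      "x \<in> carrier M \<Longrightarrow> x \<star>\<^bsub>M\<^esub> \<one>\<^bsub>R\<^esub> = x"

definition regular_rmodule :: "('a, 'r) ring_scheme \<Rightarrow> ('a, 'a) rmodule" where
  "regular_rmodule R =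
    \<lparr>carrier = carrier R, mult = mult R, one = one R, zero = zero R, add = add R,
     rsmult = mult R\<rparr>"

definition rsubmodule ::
    "('a, 'r) ring_scheme \<Rightarrow> ('a, 'b, 'm) rmodule_scheme \<Rightarrow> 'b set \<Rightarrow> bool" where
  "rsubmodule R M N \<longleftrightarrow>
    subgroup N (add_monoid M) \<and> (\<forall>x\<in>N. \<forall>r\<in>carrier R. x \<star>\<^bsub>M\<^esub> r \<in> N)"

definition rmodule_hom ::
    "('a, 'r) ring_scheme \<Rightarrow> ('a, 'b, 'm) rmodule_scheme \<Rightarrow> ('a, 'c, 'n) rmodule_scheme \<Rightarrow>
      ('b \<Rightarrow> 'c) set" where
  "rmodule_hom R M N =
    {f. f \<in> carrier M \<rightarrow> carrier N \<and>
        (\<forall>x\<in>carrier M. \<forall>y\<in>carrier M. f (x \<oplus>\<^bsub>M\<^esub> y) = f x \<oplus>\<^bsub>N\<^esub> f y) \<and>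
        (\<forall>x\<in>carrier M. \<forall>r\<in>carrier R. f (x \<star>\<^bsub>M\<^esub> r) = f x \<star>\<^bsub>N\<^esub> r)}"

definition cyclic_rmodule ::
    "('a, 'r) ring_scheme \<Rightarrow> ('a, 'b, 'm) rmodule_scheme \<Rightarrow> bool" where
  "cyclic_rmodule R M \<longleftrightarrow>
    right_module R M \<and> (\<exists>x\<in>carrier M. carrier M = {x \<star>\<^bsub>M\<^esub> r | r. r \<in> carrier R})"

definition simple_rmodule ::
    "('a, 'r) ring_scheme \<Rightarrow> ('a, 'b, 'm) rmodule_scheme \<Rightarrow> bool" where
  "simple_rmodule R M \<longleftrightarrow>
    right_module R M \<and> carrier M \<noteq> {\<zero>\<^bsub>M\<^esub>} \<and>
    (\<forall>N. rsubmodule R M N \<longrightarrow> N = {\<zero>\<^bsub>M\<^esub>} \<or> N = carrier M)"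

definition internal_direct_sum ::
    "('a, 'r) ring_scheme \<Rightarrow> ('a, 'b, 'm) rmodule_scheme \<Rightarrow> 'b set \<Rightarrow> 'b set \<Rightarrow> bool" where
  "internal_direct_sum R M P N \<longleftrightarrow>
    rsubmodule R M P \<and> rsubmodule R M N \<and>
    P <+>\<^bsub>M\<^esub> N = carrier M \<and> P \<inter> N = {\<zero>\<^bsub>M\<^esub>}"

definition direct_summand ::
    "('a, 'r) ring_scheme \<Rightarrow> ('a, 'b, 'm) rmodule_scheme \<Rightarrow> 'b set \<Rightarrow> bool" where
  "direct_summand R M P \<longleftrightarrow> (\<exists>N. internal_direct_sum R M P N)"

definition semisimple_rmodule ::
    "('a, 'r) ring_scheme \<Rightarrow> ('a, 'b, 'm) rmodule_scheme \<Rightarrow> bool" where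
  "semisimple_rmodule R M \<longleftrightarrow>
    right_module R M \<and> (\<forall>N. rsubmodule R M N \<longrightarrow> direct_summand R M N)"

definition semisimple_ring :: "('a, 'r) ring_scheme \<Rightarrow> bool" where
  "semisimple_ring R \<longleftrightarrow> ring R \<and> semisimple_rmodule R (regular_rmodule R)"


section \<open>Injective and projective modules\<close>

text \<open>
  HOL has no quantification over types inside a definition, so the test modules in the
  following two definitions have to live on a fixed type, chosen large enough that nothing is
  lost. For a module on the type \<open>'b\<close> the type \<open>'b \<Rightarrow> 'a\<close> contains a copy of the regular
  module (which with Baer's criterion suffices for injectivity) and the free module on the
  carrier (which suffices for projectivity). The theorems \<open>injective_rmodule_extends\<close> and
  \<open>projective_rmodule_lifts\<close> below establish the extension and lifting properties for test
  modules on arbitrary types.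
\<close>

definition injective_rmodule ::
    "('a, 'r) ring_scheme \<Rightarrow> ('a, 'b, 'm) rmodule_scheme \<Rightarrow> bool" where
  "injective_rmodule R E \<longleftrightarrow>
    right_module R E \<and>
    (\<forall>(A :: ('a, 'b \<Rightarrow> 'a) rmodule) (B :: ('a, 'b \<Rightarrow> 'a) rmodule).
      right_module R A \<and> right_module R B \<longrightarrow>
      (\<forall>i\<in>rmodule_hom R A B. \<forall>f\<in>rmodule_hom R A E. inj_on i (carrier A) \<longrightarrow>
        (\<exists>h\<in>rmodule_hom R B E. \<forall>x\<in>carrier A. h (i x) = f x)))"

definition projective_rmodule ::
    "('a, 'r) ring_scheme \<Rightarrow> ('a, 'b, 'm) rmodule_scheme \<Rightarrow> bool" where
  "projective_rmodule R P \<longleftrightarrow>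
    right_module R P \<and>
    (\<forall>(B :: ('a, 'b \<Rightarrow> 'a) rmodule) (C :: ('a, 'b \<Rightarrow> 'a) rmodule).
      right_module R B \<and> right_module R C \<longrightarrow>
      (\<forall>g\<in>rmodule_hom R B C. \<forall>f\<in>rmodule_hom R P C. g ` carrier B = carrier C \<longrightarrow>
        (\<exists>h\<in>rmodule_hom R P B. \<forall>x\<in>carrier P. g (h x) = f x)))"

definition stable_rmodule ::
    "('a, 'r) ring_scheme \<Rightarrow> ('a, 'b, 'm) rmodule_scheme \<Rightarrow> bool" where
  "stable_rmodule R M \<longleftrightarrow>
    right_module R M \<and>
    (\<forall>P. direct_summand R M P \<and> projective_rmodule R (M\<lparr>carrier := P\<rparr>) \<longrightarrow> P = {\<zero>\<^bsub>M\<^esub>})"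


section \<open>Semiartinian rings and V-rings\<close>

text \<open>
  Modules here live on the type \<open>'a set\<close>, which contains a copy \<open>R/I\<close> of every cyclic module.
  That modules on arbitrary types are covered is established by the theorems
  \<open>right_semiartinian_any_type\<close> and \<open>right_V_ring_any_type\<close> below.
\<close>

definition right_semiartinian :: "('a, 'r) ring_scheme \<Rightarrow> bool" where
  "right_semiartinian R \<longleftrightarrow>
    ring R \<and>
    (\<forall>M :: ('a, 'a set) rmodule. right_module R M \<and> carrier M \<noteq> {\<zero>\<^bsub>M\<^esub>} \<longrightarrow>
      (\<exists>S. rsubmodule R M S \<and> simple_rmodule R (M\<lparr>carrier := S\<rparr>)))"

definition right_V_ring :: "('a, 'r) ring_scheme \<Rightarrow> bool" where
  "right_V_ring R \<longleftrightarrow>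
    ring R \<and>
    (\<forall>S :: ('a, 'a set) rmodule. simple_rmodule R S \<longrightarrow> injective_rmodule R S)"


section \<open>Independence of the chosen types: copies of modules\<close>

lemma right_moduleI:
  fixes R (structure) and M (structure)
  assumes "ring R"
    and "\<And>x y. \<lbrakk>x \<in> carrier M; y \<in> carrier M\<rbrakk> \<Longrightarrow> x \<oplus>\<^bsub>M\<^esub> y \<in> carrier M"
    and "\<zero>\<^bsub>M\<^esub> \<in> carrier M"
    and "\<And>x y z. \<lbrakk>x \<in> carrier M; y \<in> carrier M; z \<in> carrier M\<rbrakk> \<Longrightarrow>
      (x \<oplus>\<^bsub>M\<^esub> y) \<oplus>\<^bsub>M\<^esub> z = x \<oplus>\<^bsub>M\<^esub> (y \<oplus>\<^bsub>M\<^esub> z)"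
    and "\<And>x y. \<lbrakk>x \<in> carrier M; y \<in> carrier M\<rbrakk> \<Longrightarrow> x \<oplus>\<^bsub>M\<^esub> y = y \<oplus>\<^bsub>M\<^esub> x"
    and "\<And>x. x \<in> carrier M \<Longrightarrow> \<zero>\<^bsub>M\<^esub> \<oplus>\<^bsub>M\<^esub> x = x"
    and "\<And>x. x \<in> carrier M \<Longrightarrow> \<exists>y\<in>carrier M. y \<oplus>\<^bsub>M\<^esub> x = \<zero>\<^bsub>M\<^esub>"
    and "\<And>x r. \<lbrakk>x \<in> carrier M; r \<in> carrier R\<rbrakk> \<Longrightarrow> x \<star>\<^bsub>M\<^esub> r \<in> carrier M"
    and "\<And>x y r. \<lbrakk>x \<in> carrier M; y \<in> carrier M; r \<in> carrier R\<rbrakk> \<Longrightarrow>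
        (x \<oplus>\<^bsub>M\<^esub> y) \<star>\<^bsub>M\<^esub> r = x \<star>\<^bsub>M\<^esub> r \<oplus>\<^bsub>M\<^esub> y \<star>\<^bsub>M\<^esub> r"
    and "\<And>x r s. \<lbrakk>x \<in> carrier M; r \<in> carrier R; s \<in> carrier R\<rbrakk> \<Longrightarrow>
        x \<star>\<^bsub>M\<^esub> (r \<oplus>\<^bsub>R\<^esub> s) = x \<star>\<^bsub>M\<^esub> r \<oplus>\<^bsub>M\<^esub> x \<star>\<^bsub>M\<^esub> s"
    and "\<And>x r s. \<lbrakk>x \<in> carrier M; r \<in> carrier R; s \<in> carrier R\<rbrakk> \<Longrightarrow>
        x \<star>\<^bsub>M\<^esub> (r \<otimes>\<^bsub>R\<^esub> s) = (x \<star>\<^bsub>M\<^esub> r) \<star>\<^bsub>M\<^esub> s"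
    and "\<And>x. x \<in> carrier M \<Longrightarrow> x \<star>\<^bsub>M\<^esub> \<one>\<^bsub>R\<^esub> = x"
  shows "right_module R M"
  by (intro right_module.intro right_module_axioms.intro abelian_groupI assms) assumption+

lemma (in right_module) rsmult_zero_left [simp]: "r \<in> carrier R \<Longrightarrow> \<zero>\<^bsub>M\<^esub> \<star>\<^bsub>M\<^esub> r = \<zero>\<^bsub>M\<^esub>"
  using rsmult_add_left[of "\<zero>\<^bsub>M\<^esub>" "\<zero>\<^bsub>M\<^esub>" r]
  by (metis M.add.l_cancel_one' M.zero_closed M.l_zero rsmult_closed)

lemma (in right_module) rsmult_zero_right [simp]: "x \<in> carrier M \<Longrightarrow> x \<star>\<^bsub>M\<^esub> \<zero>\<^bsub>R\<^esub> = \<zero>\<^bsub>M\<^esub>"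
  using rsmult_add_right[of x "\<zero>\<^bsub>R\<^esub>" "\<zero>\<^bsub>R\<^esub>"]
  by (metis M.add.l_cancel_one' R.zero_closed R.l_zero rsmult_closed)

lemma (in right_module) rsmult_minus_one:
  "x \<in> carrier M \<Longrightarrow> x \<star>\<^bsub>M\<^esub> (\<ominus>\<^bsub>R\<^esub> \<one>\<^bsub>R\<^esub>) = \<ominus>\<^bsub>M\<^esub> x"
  using rsmult_add_right[of x "\<ominus>\<^bsub>R\<^esub> \<one>\<^bsub>R\<^esub>" "\<one>\<^bsub>R\<^esub>"]
  by (metis M.minus_equality R.a_inv_closed R.l_neg R.one_closed rsmult_closed rsmult_one
      rsmult_zero_right)

lemma (in right_module) rsubmoduleI:
  assumes "N \<subseteq> carrier M" "\<zero>\<^bsub>M\<^esub> \<in> N"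
    and "\<And>x y. \<lbrakk>x \<in> N; y \<in> N\<rbrakk> \<Longrightarrow> x \<oplus>\<^bsub>M\<^esub> y \<in> N"
    and "\<And>x r. \<lbrakk>x \<in> N; r \<in> carrier R\<rbrakk> \<Longrightarrow> x \<star>\<^bsub>M\<^esub> r \<in> N"
  shows "rsubmodule R M N"
  unfolding rsubmodule_def
proof
  show "subgroup N (add_monoid M)"
  proof (rule M.add.subgroupI)
    show "\<ominus>\<^bsub>M\<^esub> x \<in> N" if "x \<in> N" for x
      using that assms(1) assms(4)[of x "\<ominus>\<^bsub>R\<^esub> \<one>\<^bsub>R\<^esub>"] rsmult_minus_one[of x] by auto
  qed (use assms in auto)
qed (use assms in blast)

lemma rsubmoduleD:
  assumes "rsubmodule R M N"
  shows "N \<subseteq> carrier M" "\<zero>\<^bsub>M\<^esub> \<in> N"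
    and "\<And>x y. \<lbrakk>x \<in> N; y \<in> N\<rbrakk> \<Longrightarrow> x \<oplus>\<^bsub>M\<^esub> y \<in> N"
    and "\<And>x r. \<lbrakk>x \<in> N; r \<in> carrier R\<rbrakk> \<Longrightarrow> x \<star>\<^bsub>M\<^esub> r \<in> N"
  using assms subgroup.subset[of N "add_monoid M"] subgroup.one_closed[of N "add_monoid M"]
    subgroup.m_closed[of N "add_monoid M"]
  unfolding rsubmodule_def by auto

lemma (in right_module) rsubmodule_right_module:
  assumes "rsubmodule R M N"
  shows "right_module R (M\<lparr>carrier := N\<rparr>)"
proof -
  note D = rsubmoduleD[OF assms]
  show ?thesis
  proof (rule right_moduleI)
    fix x assume x: "x \<in> carrier (M\<lparr>carrier := N\<rparr>)"
    then have "x \<star>\<^bsub>M\<^esub> (\<ominus>\<^bsub>R\<^esub> \<one>\<^bsub>R\<^esub>) \<in> N" using D(4) by simp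
    moreover have "x \<star>\<^bsub>M\<^esub> (\<ominus>\<^bsub>R\<^esub> \<one>\<^bsub>R\<^esub>) \<oplus>\<^bsub>M\<^esub> x = \<zero>\<^bsub>M\<^esub>"
      using x D(1) by (subst rsmult_minus_one) (auto intro: M.l_neg)
    ultimately show "\<exists>y\<in>carrier (M\<lparr>carrier := N\<rparr>).
        y \<oplus>\<^bsub>M\<lparr>carrier := N\<rparr>\<^esub> x = \<zero>\<^bsub>M\<lparr>carrier := N\<rparr>\<^esub>" by auto
  qed (use D in \<open>auto simp: rsmult_add_left rsmult_add_right rsmult_assoc M.a_ac
        R.ring_axioms subset_iff\<close>)
qed

definition transport_rmodule ::
    "('b \<Rightarrow> 'c) \<Rightarrow> ('a, 'b, 'm) rmodule_scheme \<Rightarrow> ('a, 'c) rmodule" where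
  "transport_rmodule j M =
    (let k = the_inv_into (carrier M) j in
    \<lparr>carrier = j ` carrier M, mult = (\<lambda>x y. j (k x \<otimes>\<^bsub>M\<^esub> k y)), one = j \<one>\<^bsub>M\<^esub>,
     zero = j \<zero>\<^bsub>M\<^esub>, add = (\<lambda>x y. j (k x \<oplus>\<^bsub>M\<^esub> k y)),
     rsmult = (\<lambda>x r. j (k x \<star>\<^bsub>M\<^esub> r))\<rparr>)"

context right_module begin

context fixes j :: "'b \<Rightarrow> 'c" assumes inj: "inj_on j (carrier M)" begin

lemma transport_simps:
  "carrier (transport_rmodule j M) = j ` carrier M"
  "\<zero>\<^bsub>transport_rmodule j M\<^esub> = j \<zero>\<^bsub>M\<^esub>"
  "\<lbrakk>x \<in> carrier M; y \<in> carrier M\<rbrakk> \<Longrightarrow> j x \<oplus>\<^bsub>transport_rmodule j M\<^esub> j y = j (x \<oplus>\<^bsub>M\<^esub> y)"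
  "x \<in> carrier M \<Longrightarrow> j x \<star>\<^bsub>transport_rmodule j M\<^esub> r = j (x \<star>\<^bsub>M\<^esub> r)"
  by (simp_all add: transport_rmodule_def Let_def the_inv_into_f_f[OF inj])

lemma transport_right_module: "right_module R (transport_rmodule j M)"
proof (rule right_moduleI)
  fix x assume "x \<in> carrier (transport_rmodule j M)"
  then obtain a where a: "a \<in> carrier M" "x = j a" by (auto simp: transport_simps)
  then have "j (\<ominus>\<^bsub>M\<^esub> a) \<oplus>\<^bsub>transport_rmodule j M\<^esub> x = \<zero>\<^bsub>transport_rmodule j M\<^esub>"
    by (simp add: transport_simps M.l_neg)
  with a show "\<exists>y\<in>carrier (transport_rmodule j M).
      y \<oplus>\<^bsub>transport_rmodule j M\<^esub> x = \<zero>\<^bsub>transport_rmodule j M\<^esub>"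
    by (auto simp: transport_simps(1))
qed (auto simp: transport_simps M.a_ac rsmult_add_left rsmult_add_right rsmult_assoc
      R.ring_axioms)

lemma transport_hom: "j \<in> rmodule_hom R M (transport_rmodule j M)"
  by (auto simp: rmodule_hom_def transport_simps)

lemma transport_hom_inv:
  "the_inv_into (carrier M) j \<in> rmodule_hom R (transport_rmodule j M) M"
  by (auto simp: rmodule_hom_def transport_simps the_inv_into_f_f[OF inj])

end

end

lemma rmodule_hom_compose:
  assumes "f \<in> rmodule_hom R L M" "g \<in> rmodule_hom R M N"
  shows "(\<lambda>x. g (f x)) \<in> rmodule_hom R L N"
  using assms unfolding rmodule_hom_def by (auto simp: Pi_iff)

lemma rmodule_homD:
  assumes "f \<in> rmodule_hom R M N"
  shows "x \<in> carrier M \<Longrightarrow> f x \<in> carrier N"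
    and "\<lbrakk>x \<in> carrier M; y \<in> carrier M\<rbrakk> \<Longrightarrow> f (x \<oplus>\<^bsub>M\<^esub> y) = f x \<oplus>\<^bsub>N\<^esub> f y"
    and "\<lbrakk>x \<in> carrier M; r \<in> carrier R\<rbrakk> \<Longrightarrow> f (x \<star>\<^bsub>M\<^esub> r) = f x \<star>\<^bsub>N\<^esub> r"
  using assms unfolding rmodule_hom_def by auto

lemma rmodule_hom_zero:
  assumes "right_module R M" "right_module R N" "f \<in> rmodule_hom R M N"
  shows "f \<zero>\<^bsub>M\<^esub> = \<zero>\<^bsub>N\<^esub>"
proof -
  interpret M: right_module R M by fact
  interpret N: right_module R N by fact
  have "f (\<zero>\<^bsub>M\<^esub> \<star>\<^bsub>M\<^esub> \<zero>\<^bsub>R\<^esub>) = f \<zero>\<^bsub>M\<^esub> \<star>\<^bsub>N\<^esub> \<zero>\<^bsub>R\<^esub>"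
    using rmodule_homD(3)[OF assms(3), of "\<zero>\<^bsub>M\<^esub>" "\<zero>\<^bsub>R\<^esub>"] by simp
  then show ?thesis using rmodule_homD(1)[OF assms(3), of "\<zero>\<^bsub>M\<^esub>"] by simp
qed

lemma regular_right_module:
  assumes "ring R"
  shows "right_module R (regular_rmodule R)"
proof -
  interpret ring R by fact
  show ?thesis
    by (rule right_moduleI)
      (auto simp: regular_rmodule_def ring_axioms a_ac l_distr r_distr m_assoc
        intro: bexI[of _ "\<ominus>\<^bsub>R\<^esub> _"] l_neg)
qed


section \<open>Baer's criterion\<close>

lemma injective_rmoduleD:
  fixes E :: "('a, 'b, 'm) rmodule_scheme" and A B :: "('a, 'b \<Rightarrow> 'a) rmodule"
  assumes "injective_rmodule R E" "right_module R A" "right_module R B"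
    and "i \<in> rmodule_hom R A B" "f \<in> rmodule_hom R A E" "inj_on i (carrier A)"
  obtains h where "h \<in> rmodule_hom R B E" "\<And>x. x \<in> carrier A \<Longrightarrow> h (i x) = f x"
proof -
  have "\<exists>h\<in>rmodule_hom R B E. \<forall>x\<in>carrier A. h (i x) = f x"
    using assms(1)[unfolded injective_rmodule_def, THEN conjunct2, rule_format, of A B i f]
      assms(2-6) by simp
  then show thesis using that by (elim bexE) simp
qed

lemma Baer_condition:
  assumes E: "injective_rmodule R (E :: ('a, 'b, 'm) rmodule_scheme)"
    and I: "rsubmodule R (regular_rmodule R) I"
    and f: "f \<in> rmodule_hom R ((regular_rmodule R)\<lparr>carrier := I\<rparr>) E"
  shows "\<exists>e\<in>carrier E. \<forall>r\<in>I. f r = e \<star>\<^bsub>E\<^esub> r"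
proof -
  interpret E: right_module R E using E by (simp add: injective_rmodule_def)
  let ?R = "regular_rmodule R" and ?j = "\<lambda>(r :: 'a) (_ :: 'b). r"
  interpret B: right_module R ?R by (rule regular_right_module) (rule E.R.ring_axioms)
  interpret A: right_module R "?R\<lparr>carrier := I\<rparr>" by (rule B.rsubmodule_right_module) (rule I)
  let ?A = "transport_rmodule ?j (?R\<lparr>carrier := I\<rparr>)" and ?B = "transport_rmodule ?j ?R"
  let ?k = "the_inv_into (carrier (?R\<lparr>carrier := I\<rparr>)) ?j"
  have jA: "inj_on ?j (carrier (?R\<lparr>carrier := I\<rparr>))" and jB: "inj_on ?j (carrier ?R)"
    by (auto simp: inj_on_def fun_eq_iff)
  have incl: "(\<lambda>x. x) \<in> rmodule_hom R (?R\<lparr>carrier := I\<rparr>) ?R"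
    using rsubmoduleD(1)[OF I] by (auto simp: rmodule_hom_def)
  have k: "?k \<in> rmodule_hom R ?A (?R\<lparr>carrier := I\<rparr>)" by (rule A.transport_hom_inv[OF jA])
  have i: "(\<lambda>x. ?j (?k x)) \<in> rmodule_hom R ?A ?B"
    by (rule rmodule_hom_compose[OF rmodule_hom_compose[OF k incl] B.transport_hom[OF jB]])
  have fk: "(\<lambda>x. f (?k x)) \<in> rmodule_hom R ?A E" by (rule rmodule_hom_compose[OF k f])
  have kj: "?k (?j r) = r" if "r \<in> I" for r
    using the_inv_into_f_f[OF jA, of r] that by simp
  have cA: "carrier ?A = ?j ` I" using A.transport_simps(1)[OF jA] by simp
  have inj: "inj_on (\<lambda>x. ?j (?k x)) (carrier ?A)"
    unfolding cA by (rule inj_onI) (auto simp: kj[simplified] fun_eq_iff)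
  obtain h where h: "h \<in> rmodule_hom R ?B E" "\<And>x. x \<in> carrier ?A \<Longrightarrow> h (?j (?k x)) = f (?k x)"
    by (rule injective_rmoduleD[OF E A.transport_right_module[OF jA]
          B.transport_right_module[OF jB] i fk inj]) (rule that)
  have cB: "carrier ?B = ?j ` carrier R"
    using B.transport_simps(1)[OF jB] by (simp add: regular_rmodule_def)
  show ?thesis
  proof (intro bexI ballI)
    show "h (?j \<one>\<^bsub>R\<^esub>) \<in> carrier E" using rmodule_homD(1)[OF h(1)] cB by blast
    fix r assume r: "r \<in> I"
    then have rR: "r \<in> carrier R" using rsubmoduleD(1)[OF I] by (auto simp: regular_rmodule_def)
    have "?j r \<in> carrier ?A" unfolding cA by (rule imageI) (rule r)
    from h(2)[OF this] have 1: "f r = h (?j r)" unfolding kj[OF r] by (rule sym)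
    have 2: "?j \<one>\<^bsub>R\<^esub> \<star>\<^bsub>?B\<^esub> r = ?j r"
      using B.transport_simps(4)[OF jB, of "\<one>\<^bsub>R\<^esub>" r] rR by (simp add: regular_rmodule_def)
    have 3: "?j \<one>\<^bsub>R\<^esub> \<in> carrier ?B" unfolding cB by (rule imageI) simp
    show "f r = h (?j \<one>\<^bsub>R\<^esub>) \<star>\<^bsub>E\<^esub> r"
      using rmodule_homD(3)[OF h(1) 3 rR] unfolding 1 2 .
  qed
qed

theorem injective_rmodule_extends:
  fixes A :: "('a, 'c, 'p) rmodule_scheme" and B :: "('a, 'd, 'q) rmodule_scheme"
    and E :: "('a, 'b, 'm) rmodule_scheme"
  assumes E: "injective_rmodule R E" and A: "right_module R A" and B: "right_module R B"
    and i: "i \<in> rmodule_hom R A B" "inj_on i (carrier A)" and f: "f \<in> rmodule_hom R A E"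
  shows "\<exists>h\<in>rmodule_hom R B E. \<forall>x\<in>carrier A. h (i x) = f x"
proof -
  interpret E: right_module R E using E by (simp add: injective_rmodule_def)
  interpret A: right_module R A by fact
  interpret B: right_module R B by fact
  define ok where "ok G \<longleftrightarrow> (\<forall>a\<in>carrier A. (i a, f a) \<in> G) \<and> G \<subseteq> carrier B \<times> carrier E \<and>
      (\<forall>x y x' y'. (x, y) \<in> G \<longrightarrow> (x', y') \<in> G \<longrightarrow> (x \<oplus>\<^bsub>B\<^esub> x', y \<oplus>\<^bsub>E\<^esub> y') \<in> G) \<and>
      (\<forall>x y. \<forall>r\<in>carrier R. (x, y) \<in> G \<longrightarrow> (x \<star>\<^bsub>B\<^esub> r, y \<star>\<^bsub>E\<^esub> r) \<in> G) \<and>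
      (\<forall>y. (\<zero>\<^bsub>B\<^esub>, y) \<in> G \<longrightarrow> y = \<zero>\<^bsub>E\<^esub>)" for G
  have okD: "\<And>a. a \<in> carrier A \<Longrightarrow> (i a, f a) \<in> G"
    "\<And>x y. (x, y) \<in> G \<Longrightarrow> x \<in> carrier B" "\<And>x y. (x, y) \<in> G \<Longrightarrow> y \<in> carrier E"
    "\<And>x y x' y'. \<lbrakk>(x, y) \<in> G; (x', y') \<in> G\<rbrakk> \<Longrightarrow> (x \<oplus>\<^bsub>B\<^esub> x', y \<oplus>\<^bsub>E\<^esub> y') \<in> G"
    "\<And>x y r. \<lbrakk>(x, y) \<in> G; r \<in> carrier R\<rbrakk> \<Longrightarrow> (x \<star>\<^bsub>B\<^esub> r, y \<star>\<^bsub>E\<^esub> r) \<in> G"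
    "\<And>y. (\<zero>\<^bsub>B\<^esub>, y) \<in> G \<Longrightarrow> y = \<zero>\<^bsub>E\<^esub>" if "ok G" for G
    using that unfolding ok_def by (blast, blast, blast, blast, blast, blast)
  have ok0: "ok {(i a, f a) | a. a \<in> carrier A}"
  proof -
    have "f a = \<zero>\<^bsub>E\<^esub>" if a: "a \<in> carrier A" and 0: "\<zero>\<^bsub>B\<^esub> = i a" for a
    proof -
      have "i a = i \<zero>\<^bsub>A\<^esub>" using 0 rmodule_hom_zero[OF A B i(1)] by simp
      then have "a = \<zero>\<^bsub>A\<^esub>" using i(2) a by (auto dest: inj_onD)
      then show ?thesis using rmodule_hom_zero[OF A E.right_module_axioms f] by simp
    qed
    moreover have "\<exists>c. i a \<oplus>\<^bsub>B\<^esub> i b = i c \<and> f a \<oplus>\<^bsub>E\<^esub> f b = f c \<and> c \<in> carrier A"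
      if "a \<in> carrier A" "b \<in> carrier A" for a b
      using that rmodule_homD(2)[OF i(1)] rmodule_homD(2)[OF f]
      by (intro exI[of _ "a \<oplus>\<^bsub>A\<^esub> b"]) simp
    moreover have "\<exists>c. i a \<star>\<^bsub>B\<^esub> r = i c \<and> f a \<star>\<^bsub>E\<^esub> r = f c \<and> c \<in> carrier A"
      if "a \<in> carrier A" "r \<in> carrier R" for a r
      using that rmodule_homD(3)[OF i(1)] rmodule_homD(3)[OF f]
      by (intro exI[of _ "a \<star>\<^bsub>A\<^esub> r"]) simp
    ultimately show ?thesis
      using rmodule_homD(1)[OF i(1)] rmodule_homD(1)[OF f] unfolding ok_def by auto
  qed
  have "\<exists>G\<in>Collect ok. \<forall>X\<in>Collect ok. G \<subseteq> X \<longrightarrow> X = G"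
  proof (rule subset_Zorn_nonempty)
    show "Collect ok \<noteq> {}" using ok0 by blast
    fix C assume C: "C \<noteq> {}" "subset.chain (Collect ok) C"
    then have okC: "\<And>X. X \<in> C \<Longrightarrow> ok X" by (auto simp: subset_chain_def)
    have up: "\<exists>X\<in>C. p \<in> X \<and> q \<in> X" if "p \<in> \<Union>C" "q \<in> \<Union>C" for p q
      using that C(2) unfolding subset_chain_def by blast
    have "(x \<oplus>\<^bsub>B\<^esub> x', y \<oplus>\<^bsub>E\<^esub> y') \<in> \<Union>C" if "(x, y) \<in> \<Union>C" "(x', y') \<in> \<Union>C" for x y x' y'
      using up[OF that] okD(4)[OF okC] by blast
    moreover have "\<Union>C \<subseteq> carrier B \<times> carrier E" using okD(2,3)[OF okC] by fast
    moreover have "\<forall>a\<in>carrier A. (i a, f a) \<in> \<Union>C" using C(1) okD(1)[OF okC] by blast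
    moreover have "(x \<star>\<^bsub>B\<^esub> r, y \<star>\<^bsub>E\<^esub> r) \<in> \<Union>C" if "(x, y) \<in> \<Union>C" "r \<in> carrier R" for x y r
      using that okD(5)[OF okC] by blast
    moreover have "y = \<zero>\<^bsub>E\<^esub>" if "(\<zero>\<^bsub>B\<^esub>, y) \<in> \<Union>C" for y using that okD(6)[OF okC] by blast
    ultimately show "\<Union>C \<in> Collect ok" unfolding ok_def by blast
  qed
  then obtain G where G: "ok G" and max: "\<And>X. ok X \<Longrightarrow> G \<subseteq> X \<Longrightarrow> X = G" by blast
  note D = okD[OF G]
  have uniq: "y = y'" if "(x, y) \<in> G" "(x, y') \<in> G" for x y y'
  proof -
    have c: "x \<in> carrier B" "y \<in> carrier E" "y' \<in> carrier E" using that D by auto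
    have "(x \<star>\<^bsub>B\<^esub> (\<ominus>\<^bsub>R\<^esub> \<one>\<^bsub>R\<^esub>), y' \<star>\<^bsub>E\<^esub> (\<ominus>\<^bsub>R\<^esub> \<one>\<^bsub>R\<^esub>)) \<in> G" using D(5) that by simp
    then have "(\<ominus>\<^bsub>B\<^esub> x, \<ominus>\<^bsub>E\<^esub> y') \<in> G" using c by (simp add: B.rsmult_minus_one E.rsmult_minus_one)
    then have "(\<zero>\<^bsub>B\<^esub>, y \<oplus>\<^bsub>E\<^esub> \<ominus>\<^bsub>E\<^esub> y') \<in> G" using D(4)[OF that(1)] c by (metis B.M.r_neg)
    then have "y \<oplus>\<^bsub>E\<^esub> \<ominus>\<^bsub>E\<^esub> y' = \<zero>\<^bsub>E\<^esub>" using D(6) by blast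
    then show ?thesis using c 
      by (metis E.M.minus_equality E.M.minus_minus E.M.a_inv_closed)
  qed
  have zero: "(\<zero>\<^bsub>B\<^esub>, \<zero>\<^bsub>E\<^esub>) \<in> G"
    using D(1)[of "\<zero>\<^bsub>A\<^esub>"] rmodule_hom_zero[OF A B i(1)]
      rmodule_hom_zero[OF A E.right_module_axioms f] by simp
  define h where "h x = (THE y. (x, y) \<in> G)" for x
  have hI: "h x = y" if "(x, y) \<in> G" for x y
    unfolding h_def using that uniq by blast
  have dom: "\<exists>y. (b, y) \<in> G" if b: "b \<in> carrier B" for b
  proof -
    define I where "I = {r \<in> carrier R. \<exists>y. (b \<star>\<^bsub>B\<^esub> r, y) \<in> G}"
    have hG: "(b \<star>\<^bsub>B\<^esub> r, h (b \<star>\<^bsub>B\<^esub> r)) \<in> G" if "r \<in> I" for r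
      using that hI unfolding I_def by blast
    interpret RR: right_module R "regular_rmodule R"
      by (rule regular_right_module) (rule E.R.ring_axioms)
    have closed: "(b \<star>\<^bsub>B\<^esub> (r \<oplus>\<^bsub>R\<^esub> s), h (b \<star>\<^bsub>B\<^esub> r) \<oplus>\<^bsub>E\<^esub> h (b \<star>\<^bsub>B\<^esub> s)) \<in> G" if "r \<in> I" "s \<in> I" for r s
      using D(4)[OF hG[OF that(1)] hG[OF that(2)]] that b unfolding I_def
      by (simp add: B.rsmult_add_right)
    have closed': "(b \<star>\<^bsub>B\<^esub> (r \<otimes>\<^bsub>R\<^esub> s), h (b \<star>\<^bsub>B\<^esub> r) \<star>\<^bsub>E\<^esub> s) \<in> G" if "r \<in> I" "s \<in> carrier R" for r s
      using D(5)[OF hG[OF that(1)] that(2)] that b unfolding I_def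
      by (simp add: B.rsmult_assoc)
    have I: "rsubmodule R (regular_rmodule R) I"
    proof (rule RR.rsubmoduleI)
      show "\<zero>\<^bsub>regular_rmodule R\<^esub> \<in> I" using zero b by (auto simp: I_def regular_rmodule_def)
      show "r \<oplus>\<^bsub>regular_rmodule R\<^esub> s \<in> I" if "r \<in> I" "s \<in> I" for r s
        using closed[OF that] that by (auto simp: I_def regular_rmodule_def)
      show "r \<star>\<^bsub>regular_rmodule R\<^esub> s \<in> I" if "r \<in> I" "s \<in> carrier R" for r s
        using closed'[OF that] that by (auto simp: I_def regular_rmodule_def)
    qed (auto simp: I_def regular_rmodule_def)
    have "(\<lambda>r. h (b \<star>\<^bsub>B\<^esub> r)) \<in> rmodule_hom R ((regular_rmodule R)\<lparr>carrier := I\<rparr>) E"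
      unfolding rmodule_hom_def using hG D(3) hI[OF closed] hI[OF closed']
      by (auto simp: regular_rmodule_def)
    from Baer_condition[OF E I this] obtain e where e: "e \<in> carrier E"
      and "\<And>r. r \<in> I \<Longrightarrow> h (b \<star>\<^bsub>B\<^esub> r) = e \<star>\<^bsub>E\<^esub> r" by blast
    then have eG: "(b \<star>\<^bsub>B\<^esub> r, e \<star>\<^bsub>E\<^esub> r) \<in> G" if "r \<in> I" for r using hG that by metis
    define G' where "G' = {(x \<oplus>\<^bsub>B\<^esub> b \<star>\<^bsub>B\<^esub> r, y \<oplus>\<^bsub>E\<^esub> e \<star>\<^bsub>E\<^esub> r) | x y r. (x, y) \<in> G \<and> r \<in> carrier R}"
    have G'I: "(u, v) \<in> G'" if "(x, y) \<in> G" "r \<in> carrier R" "u = x \<oplus>\<^bsub>B\<^esub> b \<star>\<^bsub>B\<^esub> r" "v = y \<oplus>\<^bsub>E\<^esub> e \<star>\<^bsub>E\<^esub> r"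
      for u v x y r using that unfolding G'_def by blast
    have G'E: "\<exists>x y r. (x, y) \<in> G \<and> r \<in> carrier R \<and> u = x \<oplus>\<^bsub>B\<^esub> b \<star>\<^bsub>B\<^esub> r \<and> v = y \<oplus>\<^bsub>E\<^esub> e \<star>\<^bsub>E\<^esub> r"
      if "(u, v) \<in> G'" for u v using that unfolding G'_def by blast
    have sub: "G \<subseteq> G'"
    proof safe
      fix x y assume xy: "(x, y) \<in> G"
      show "(x, y) \<in> G'"
        by (rule G'I[OF xy E.R.zero_closed]) (use b e D(2,3)[OF xy] in simp_all)
    qed
    have "ok G'"
      unfolding ok_def
    proof (intro conjI allI impI ballI)
      show "(i a, f a) \<in> G'" if "a \<in> carrier A" for a using D(1)[OF that] sub by blast
      show "G' \<subseteq> carrier B \<times> carrier E" unfolding G'_def using D(2,3) b e by auto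
    next
      fix u v u' v' assume "(u, v) \<in> G'" "(u', v') \<in> G'"
      then obtain x y r x' y' r' where *: "(x, y) \<in> G" "r \<in> carrier R" "(x', y') \<in> G" "r' \<in> carrier R"
        "u = x \<oplus>\<^bsub>B\<^esub> b \<star>\<^bsub>B\<^esub> r" "v = y \<oplus>\<^bsub>E\<^esub> e \<star>\<^bsub>E\<^esub> r" "u' = x' \<oplus>\<^bsub>B\<^esub> b \<star>\<^bsub>B\<^esub> r'" "v' = y' \<oplus>\<^bsub>E\<^esub> e \<star>\<^bsub>E\<^esub> r'"
        by (metis G'E)
      show "(u \<oplus>\<^bsub>B\<^esub> u', v \<oplus>\<^bsub>E\<^esub> v') \<in> G'"
        by (rule G'I[OF D(4)[OF *(1,3)] E.R.add.m_closed[OF *(2,4)]])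
          (use * b e D(2,3)[OF *(1)] D(2,3)[OF *(3)] in
            \<open>simp_all add: B.rsmult_add_right E.rsmult_add_right B.M.a_ac E.M.a_ac\<close>)
    next
      fix u v s assume s: "s \<in> carrier R" and "(u, v) \<in> G'"
      then obtain x y r where *: "(x, y) \<in> G" "r \<in> carrier R"
        "u = x \<oplus>\<^bsub>B\<^esub> b \<star>\<^bsub>B\<^esub> r" "v = y \<oplus>\<^bsub>E\<^esub> e \<star>\<^bsub>E\<^esub> r"
        by (metis G'E)
      show "(u \<star>\<^bsub>B\<^esub> s, v \<star>\<^bsub>E\<^esub> s) \<in> G'"
        by (rule G'I[OF D(5)[OF *(1) s] E.R.m_closed[OF *(2) s]])
          (use * s b e D(2,3)[OF *(1)] in
            \<open>simp_all add: B.rsmult_add_left E.rsmult_add_left B.rsmult_assoc E.rsmult_assoc\<close>)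
    next
      fix v assume "(\<zero>\<^bsub>B\<^esub>, v) \<in> G'"
      then obtain x y r where *: "(x, y) \<in> G" "r \<in> carrier R"
        "\<zero>\<^bsub>B\<^esub> = x \<oplus>\<^bsub>B\<^esub> b \<star>\<^bsub>B\<^esub> r" "v = y \<oplus>\<^bsub>E\<^esub> e \<star>\<^bsub>E\<^esub> r"
        by (metis G'E)
      have x: "x \<in> carrier B" using D(2)[OF *(1)] .
      have "b \<star>\<^bsub>B\<^esub> r = \<ominus>\<^bsub>B\<^esub> x"
        using *(2,3) x b by (metis B.M.a_comm B.M.minus_equality B.rsmult_closed)
      moreover have "(\<ominus>\<^bsub>B\<^esub> x, y \<star>\<^bsub>E\<^esub> (\<ominus>\<^bsub>R\<^esub> \<one>\<^bsub>R\<^esub>)) \<in> G"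
        using D(5)[OF *(1), of "\<ominus>\<^bsub>R\<^esub> \<one>\<^bsub>R\<^esub>"] x by (simp add: B.rsmult_minus_one)
      ultimately have "r \<in> I" using *(2) unfolding I_def by auto
      from D(4)[OF *(1) eG[OF this]] show "v = \<zero>\<^bsub>E\<^esub>" using *(3,4) D(6) by metis
    qed
    then have "G' = G" using max sub by blast
    moreover have "(b, e) \<in> G'"
      by (rule G'I[OF zero E.R.one_closed]) (use b e in simp_all)
    ultimately show ?thesis by blast
  qed
  have hG: "(b, h b) \<in> G" if "b \<in> carrier B" for b using dom[OF that] hI by blast
  show ?thesis
  proof (intro bexI ballI)
    show "h (i a) = f a" if "a \<in> carrier A" for a using hI D(1) that by blast
    show "h \<in> rmodule_hom R B E"
      unfolding rmodule_hom_def using hG D(3) hI[OF D(4)[OF hG hG]] hI[OF D(5)[OF hG]] by blast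
  qed
qed


section \<open>Free modules and projectivity\<close>

definition free_rmodule ::
    "('a, 'r) ring_scheme \<Rightarrow> 'b set \<Rightarrow> ('a, 'b \<Rightarrow> 'a) rmodule" where
  "free_rmodule R X =
    \<lparr>carrier = {\<phi>. (\<forall>p\<in>X. \<phi> p \<in> carrier R) \<and> (\<forall>p. p \<notin> X \<longrightarrow> \<phi> p = \<zero>\<^bsub>R\<^esub>) \<and>
        finite {p. \<phi> p \<noteq> \<zero>\<^bsub>R\<^esub>}},
     mult = undefined, one = undefined, zero = (\<lambda>_. \<zero>\<^bsub>R\<^esub>),
     add = (\<lambda>\<phi> \<psi> p. \<phi> p \<oplus>\<^bsub>R\<^esub> \<psi> p), rsmult = (\<lambda>\<phi> r p. \<phi> p \<otimes>\<^bsub>R\<^esub> r)\<rparr>"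

lemma free_carrierD:
  assumes "ring R" "\<phi> \<in> carrier (free_rmodule R X)"
  shows "\<phi> p \<in> carrier R" "p \<notin> X \<Longrightarrow> \<phi> p = \<zero>\<^bsub>R\<^esub>" "finite {p. \<phi> p \<noteq> \<zero>\<^bsub>R\<^esub>}"
    "\<phi> p \<noteq> \<zero>\<^bsub>R\<^esub> \<Longrightarrow> p \<in> X"
proof -
  interpret ring R by fact
  show "\<phi> p \<in> carrier R" "p \<notin> X \<Longrightarrow> \<phi> p = \<zero>\<^bsub>R\<^esub>" "finite {p. \<phi> p \<noteq> \<zero>\<^bsub>R\<^esub>}"
    "\<phi> p \<noteq> \<zero>\<^bsub>R\<^esub> \<Longrightarrow> p \<in> X"
    using assms(2) by (cases "p \<in> X"; auto simp: free_rmodule_def)+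
qed

lemma free_right_module:
  assumes "ring R"
  shows "right_module R (free_rmodule R X)"
proof -
  interpret ring R by fact
  note D = free_carrierD[OF assms, where X = X]
  let ?F = "free_rmodule R X"
  have s: "\<zero>\<^bsub>?F\<^esub> = (\<lambda>_. \<zero>\<^bsub>R\<^esub>)" "add ?F = (\<lambda>\<phi> \<psi> p. \<phi> p \<oplus>\<^bsub>R\<^esub> \<psi> p)" "rsmult ?F = (\<lambda>\<phi> r p. \<phi> p \<otimes>\<^bsub>R\<^esub> r)"
    by (auto simp: free_rmodule_def)
  have I: "\<phi> \<in> carrier ?F" if "\<And>p. p \<in> X \<Longrightarrow> \<phi> p \<in> carrier R" "\<And>p. p \<notin> X \<Longrightarrow> \<phi> p = \<zero>\<^bsub>R\<^esub>"
    "finite S" "{p. \<phi> p \<noteq> \<zero>\<^bsub>R\<^esub>} \<subseteq> S" for \<phi> S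
    using that(1,2) finite_subset[OF that(4,3)] unfolding free_rmodule_def by simp
  show ?thesis
  proof (rule right_moduleI)
    show "\<phi> \<oplus>\<^bsub>?F\<^esub> \<psi> \<in> carrier ?F" if "\<phi> \<in> carrier ?F" "\<psi> \<in> carrier ?F" for \<phi> \<psi>
      by (rule I[where S = "{p. \<phi> p \<noteq> \<zero>\<^bsub>R\<^esub>} \<union> {p. \<psi> p \<noteq> \<zero>\<^bsub>R\<^esub>}"])
        (use D(1-3)[OF that(1)] D(1-3)[OF that(2)] in \<open>auto simp: s\<close>)
    show "\<zero>\<^bsub>?F\<^esub> \<in> carrier ?F" by (rule I[of _ "{}"]) (auto simp: s)
    show "\<phi> \<star>\<^bsub>?F\<^esub> r \<in> carrier ?F" if "\<phi> \<in> carrier ?F" "r \<in> carrier R" for \<phi> r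
      by (rule I[where S = "{p. \<phi> p \<noteq> \<zero>\<^bsub>R\<^esub>}"]) (use D(1-3)[OF that(1)] that(2) in \<open>auto simp: s\<close>)
    fix \<phi> assume p: "\<phi> \<in> carrier ?F"
    have "(\<lambda>p. \<ominus>\<^bsub>R\<^esub> \<phi> p) \<in> carrier ?F"
      by (rule I[where S = "{p. \<phi> p \<noteq> \<zero>\<^bsub>R\<^esub>}"]) (use D(1-3)[OF p] in auto)
    moreover have "(\<lambda>p. \<ominus>\<^bsub>R\<^esub> \<phi> p) \<oplus>\<^bsub>?F\<^esub> \<phi> = \<zero>\<^bsub>?F\<^esub>" using D(1)[OF p] by (simp add: s l_neg)
    ultimately show "\<exists>\<psi>\<in>carrier ?F. \<psi> \<oplus>\<^bsub>?F\<^esub> \<phi> = \<zero>\<^bsub>?F\<^esub>" by blast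
  qed (use D(1) in \<open>auto simp: s ring_axioms fun_eq_iff a_ac l_distr r_distr m_assoc\<close>)
qed

definition lincomb where
  "lincomb R M c \<phi> = finsum M (\<lambda>p. c p \<star>\<^bsub>M\<^esub> \<phi> p) {p. \<phi> p \<noteq> \<zero>\<^bsub>R\<^esub>}"

context right_module begin

lemma lincomb_eq:
  assumes "\<phi> \<in> carrier (free_rmodule R X)" "c \<in> X \<rightarrow> carrier M"
    and "finite S" "S \<subseteq> X" "{p. \<phi> p \<noteq> \<zero>\<^bsub>R\<^esub>} \<subseteq> S"
  shows "lincomb R M c \<phi> = finsum M (\<lambda>p. c p \<star>\<^bsub>M\<^esub> \<phi> p) S"
  unfolding lincomb_def
  by (rule M.add.finprod_mono_neutral_cong_left)
    (use assms free_carrierD(1)[OF R.ring_axioms assms(1)] in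
      \<open>auto simp: Pi_iff subset_iff intro!: rsmult_closed rsmult_zero_right\<close>)

lemma lincomb_hom:
  assumes c: "c \<in> X \<rightarrow> carrier M"
  shows "lincomb R M c \<in> rmodule_hom R (free_rmodule R X) M"
proof -
  let ?F = "free_rmodule R X"
  note D = free_carrierD[OF R.ring_axioms, where X = X]
  interpret F: right_module R ?F by (rule free_right_module) (rule R.ring_axioms)
  have s: "\<And>\<phi> \<psi> p. (\<phi> \<oplus>\<^bsub>?F\<^esub> \<psi>) p = \<phi> p \<oplus>\<^bsub>R\<^esub> \<psi> p" "\<And>\<phi> r p. (\<phi> \<star>\<^bsub>?F\<^esub> r) p = \<phi> p \<otimes>\<^bsub>R\<^esub> r"
    by (auto simp: free_rmodule_def)
  have "lincomb R M c \<phi> \<in> carrier M" if "\<phi> \<in> carrier ?F" for \<phi>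
    unfolding lincomb_def by (rule M.finsum_closed) (use D(1,4)[OF that] c in auto)
  moreover have "lincomb R M c (\<phi> \<oplus>\<^bsub>?F\<^esub> \<psi>) = lincomb R M c \<phi> \<oplus>\<^bsub>M\<^esub> lincomb R M c \<psi>"
    if p: "\<phi> \<in> carrier ?F" and q: "\<psi> \<in> carrier ?F" for \<phi> \<psi>
  proof -
    let ?S = "{p. \<phi> p \<noteq> \<zero>\<^bsub>R\<^esub>} \<union> {p. \<psi> p \<noteq> \<zero>\<^bsub>R\<^esub>}"
    have S: "finite ?S" "?S \<subseteq> X" using D(3,4)[OF p] D(3,4)[OF q] by auto
    have "lincomb R M c (\<phi> \<oplus>\<^bsub>?F\<^esub> \<psi>) = finsum M (\<lambda>p. c p \<star>\<^bsub>M\<^esub> (\<phi> \<oplus>\<^bsub>?F\<^esub> \<psi>) p) ?S"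
      by (rule lincomb_eq[OF F.M.add.m_closed[OF p q] c S]) (auto simp: s)
    also have "\<dots> = finsum M (\<lambda>p. c p \<star>\<^bsub>M\<^esub> \<phi> p \<oplus>\<^bsub>M\<^esub> c p \<star>\<^bsub>M\<^esub> \<psi> p) ?S"
      by (rule M.finsum_cong') (use c S(2) D(1)[OF p] D(1)[OF q] in \<open>auto simp: s rsmult_add_right Pi_iff subset_iff\<close>)
    also have "\<dots> = finsum M (\<lambda>p. c p \<star>\<^bsub>M\<^esub> \<phi> p) ?S \<oplus>\<^bsub>M\<^esub> finsum M (\<lambda>p. c p \<star>\<^bsub>M\<^esub> \<psi> p) ?S"
      by (rule M.finsum_addf) (use c S(2) D(1)[OF p] D(1)[OF q] in
          \<open>auto simp: Pi_iff subset_iff intro!: rsmult_closed\<close>)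
    also have "\<dots> = lincomb R M c \<phi> \<oplus>\<^bsub>M\<^esub> lincomb R M c \<psi>"
      using lincomb_eq[OF p c S] lincomb_eq[OF q c S] by simp
    finally show ?thesis .
  qed
  moreover have "lincomb R M c (\<phi> \<star>\<^bsub>?F\<^esub> r) = lincomb R M c \<phi> \<star>\<^bsub>M\<^esub> r"
    if p: "\<phi> \<in> carrier ?F" and r: "r \<in> carrier R" for \<phi> r
  proof -
    let ?S = "{p. \<phi> p \<noteq> \<zero>\<^bsub>R\<^esub>}"
    have S: "finite ?S" "?S \<subseteq> X" using D(3,4)[OF p] by auto
    have "lincomb R M c (\<phi> \<star>\<^bsub>?F\<^esub> r) = finsum M (\<lambda>p. c p \<star>\<^bsub>M\<^esub> (\<phi> \<star>\<^bsub>?F\<^esub> r) p) ?S"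
      by (rule lincomb_eq[OF F.rsmult_closed[OF p r] c S]) (use r in \<open>auto simp: s\<close>)
    also have "\<dots> = finsum M (\<lambda>p. (c p \<star>\<^bsub>M\<^esub> \<phi> p) \<star>\<^bsub>M\<^esub> r) ?S"
      by (rule M.finsum_cong') (use c S(2) D(1)[OF p] r in \<open>auto simp: s rsmult_assoc Pi_iff subset_iff\<close>)
    also have "\<dots> = finsum M (\<lambda>p. c p \<star>\<^bsub>M\<^esub> \<phi> p) ?S \<star>\<^bsub>M\<^esub> r"
    proof -
      have "finsum M (\<lambda>p. (c p \<star>\<^bsub>M\<^esub> \<phi> p) \<star>\<^bsub>M\<^esub> r) T = finsum M (\<lambda>p. c p \<star>\<^bsub>M\<^esub> \<phi> p) T \<star>\<^bsub>M\<^esub> r"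
        if "finite T" "T \<subseteq> X" for T
        using that
      proof (induction T rule: finite_induct)
        case (insert a T)
        have "(\<lambda>p. c p \<star>\<^bsub>M\<^esub> \<phi> p) \<in> T \<rightarrow> carrier M" "c a \<star>\<^bsub>M\<^esub> \<phi> a \<in> carrier M"
          "(\<lambda>p. (c p \<star>\<^bsub>M\<^esub> \<phi> p) \<star>\<^bsub>M\<^esub> r) \<in> T \<rightarrow> carrier M" "(c a \<star>\<^bsub>M\<^esub> \<phi> a) \<star>\<^bsub>M\<^esub> r \<in> carrier M"
          using insert.prems c D(1)[OF p] r by (auto simp: Pi_iff subset_iff intro!: rsmult_closed)
        then show ?case using insert r by (simp add: rsmult_add_left M.finsum_insert)
      qed (use r in simp)
      then show ?thesis using S by blast
    qed
    finally show ?thesis by (simp add: lincomb_def)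
  qed
  ultimately show ?thesis unfolding rmodule_hom_def by auto
qed

end

lemma hom_lincomb:
  assumes M: "right_module R M" and N: "right_module R N" and u: "u \<in> rmodule_hom R M N"
    and c: "c \<in> X \<rightarrow> carrier M" and p: "\<phi> \<in> carrier (free_rmodule R X)"
  shows "u (lincomb R M c \<phi>) = lincomb R N (\<lambda>p. u (c p)) \<phi>"
proof -
  interpret M: right_module R M by fact
  interpret N: right_module R N by fact
  note D = free_carrierD[OF M.R.ring_axioms p] and U = rmodule_homD[OF u]
  have "u (finsum M (\<lambda>p. c p \<star>\<^bsub>M\<^esub> \<phi> p) T) = finsum N (\<lambda>p. u (c p) \<star>\<^bsub>N\<^esub> \<phi> p) T"
    if "finite T" "T \<subseteq> X" for T
    using that
  proof (induction T rule: finite_induct)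
    case empty
    then show ?case using rmodule_hom_zero[OF M N u] by simp
  next
    case (insert a T)
    have *: "(\<lambda>p. c p \<star>\<^bsub>M\<^esub> \<phi> p) \<in> T \<rightarrow> carrier M" "c a \<in> carrier M" "c a \<star>\<^bsub>M\<^esub> \<phi> a \<in> carrier M"
      using insert.prems c D(1) by auto
    have "(\<lambda>p. u (c p) \<star>\<^bsub>N\<^esub> \<phi> p) \<in> T \<rightarrow> carrier N" "u (c a) \<star>\<^bsub>N\<^esub> \<phi> a \<in> carrier N"
      using insert.prems c D(1) U(1) by (auto simp: Pi_iff subset_iff)
    with * show ?case using insert U(2,3) D(1)
      by (simp add: M.M.finsum_insert N.M.finsum_insert)
  qed
  moreover have "{p. \<phi> p \<noteq> \<zero>\<^bsub>R\<^esub>} \<subseteq> X" using D(4) by auto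
  ultimately show ?thesis using D(3) by (simp add: lincomb_def)
qed

theorem projective_rmodule_lifts:
  fixes B :: "('a, 'c, 'p) rmodule_scheme" and C :: "('a, 'd, 'q) rmodule_scheme"
    and P :: "('a, 'b, 'm) rmodule_scheme"
  assumes P: "projective_rmodule R P" and B: "right_module R B" and C: "right_module R C"
    and g: "g \<in> rmodule_hom R B C" "g ` carrier B = carrier C" and f: "f \<in> rmodule_hom R P C"
  shows "\<exists>h\<in>rmodule_hom R P B. \<forall>x\<in>carrier P. g (h x) = f x"
proof (cases "\<one>\<^bsub>R\<^esub> = \<zero>\<^bsub>R\<^esub>")
  case True
  interpret B: right_module R B by fact
  interpret C: right_module R C by fact
  have C0: "x = \<zero>\<^bsub>C\<^esub>" if "x \<in> carrier C" for x
    using C.rsmult_one[OF that] C.rsmult_zero_right[OF that] True by simp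
  have "(\<lambda>_. \<zero>\<^bsub>B\<^esub>) \<in> rmodule_hom R P B" by (auto simp: rmodule_hom_def)
  moreover have "g \<zero>\<^bsub>B\<^esub> = f x" if "x \<in> carrier P" for x
    using C0[OF rmodule_homD(1)[OF f that]] C0[OF rmodule_homD(1)[OF g(1) B.M.zero_closed]] by simp
  ultimately show ?thesis by (intro bexI[of _ "\<lambda>_. \<zero>\<^bsub>B\<^esub>"] ballI)
next
  case False
  interpret P: right_module R P using P by (simp add: projective_rmodule_def)
  interpret B: right_module R B by fact
  interpret C: right_module R C by fact
  let ?F = "free_rmodule R (carrier P)"
  interpret F: right_module R ?F by (rule free_right_module) (rule P.R.ring_axioms)
  define d where "d p = (\<lambda>q. if q = p then \<one>\<^bsub>R\<^esub> else \<zero>\<^bsub>R\<^esub>)" for p :: 'b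
  have inj: "inj_on d (carrier P)"
    by (rule inj_onI) (metis d_def False)
  have supp: "{q. d p q \<noteq> \<zero>\<^bsub>R\<^esub>} = {p}" for p using False by (auto simp: d_def)
  have dF: "d p \<in> carrier ?F" if "p \<in> carrier P" for p
    using that supp[of p] by (auto simp: free_rmodule_def d_def)
  have id: "(\<lambda>p. p) \<in> carrier P \<rightarrow> carrier P" by simp
  have ld: "lincomb R P (\<lambda>p. p) (d p) = p" if "p \<in> carrier P" for p
    using that unfolding lincomb_def supp by (simp add: d_def)
  note L = P.lincomb_hom[OF id]
  let ?P = "transport_rmodule d P"
  have "(\<lambda>\<phi>. d (lincomb R P (\<lambda>p. p) \<phi>)) \<in> rmodule_hom R ?F ?P"
    by (rule rmodule_hom_compose[OF L P.transport_hom[OF inj]])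
  moreover have "(\<lambda>\<phi>. d (lincomb R P (\<lambda>p. p) \<phi>)) ` carrier ?F = carrier ?P"
  proof
    show "(\<lambda>\<phi>. d (lincomb R P (\<lambda>p. p) \<phi>)) ` carrier ?F \<subseteq> carrier ?P"
      using rmodule_homD(1)[OF L] by (auto simp: P.transport_simps(1)[OF inj])
    show "carrier ?P \<subseteq> (\<lambda>\<phi>. d (lincomb R P (\<lambda>p. p) \<phi>)) ` carrier ?F"
    proof
      fix y assume "y \<in> carrier ?P"
      then obtain p where p: "p \<in> carrier P" "y = d p" by (auto simp: P.transport_simps(1)[OF inj])
      then have "y = d (lincomb R P (\<lambda>p. p) (d p))" using ld by simp
      then show "y \<in> (\<lambda>\<phi>. d (lincomb R P (\<lambda>p. p) \<phi>)) ` carrier ?F" using dF[OF p(1)] by blast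
    qed
  qed
  ultimately obtain s where s: "s \<in> rmodule_hom R P ?F"
    "\<And>x. x \<in> carrier P \<Longrightarrow> d (lincomb R P (\<lambda>p. p) (s x)) = d x"
    using P F.right_module_axioms P.transport_right_module[OF inj] P.transport_hom[OF inj]
    unfolding projective_rmodule_def by blast
  have s': "lincomb R P (\<lambda>p. p) (s x) = x" if "x \<in> carrier P" for x
    using s(2)[OF that] inj_onD[OF inj] rmodule_homD(1)[OF L rmodule_homD(1)[OF s(1) that]] that
    by blast
  have "\<forall>p\<in>carrier P. \<exists>b\<in>carrier B. g b = f p"
    using g(2) rmodule_homD(1)[OF f] by (metis imageE)
  then obtain c where c: "\<And>p. p \<in> carrier P \<Longrightarrow> c p \<in> carrier B \<and> g (c p) = f p" by metis
  then have cB: "c \<in> carrier P \<rightarrow> carrier B" by blast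
  show ?thesis
  proof (intro bexI ballI)
    show "(\<lambda>x. lincomb R B c (s x)) \<in> rmodule_hom R P B"
      by (rule rmodule_hom_compose[OF s(1) B.lincomb_hom[OF cB]])
    fix x assume x: "x \<in> carrier P"
    note sx = rmodule_homD(1)[OF s(1) x]
    note D = free_carrierD[OF P.R.ring_axioms sx]
    have "g (lincomb R B c (s x)) = lincomb R C (\<lambda>p. g (c p)) (s x)"
      by (rule hom_lincomb[OF B C g(1) cB sx])
    also have "\<dots> = lincomb R C f (s x)"
      unfolding lincomb_def
      by (rule C.M.finsum_cong') (use c D(1,4) rmodule_homD(1)[OF f] in auto)
    also have "\<dots> = f (lincomb R P (\<lambda>p. p) (s x))"
      by (rule hom_lincomb[OF P.right_module_axioms C f id sx, symmetric])
    finally show "g (lincomb R B c (s x)) = f x" using s'[OF x] by simp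
  qed
qed


section \<open>Semiartinian rings and V-rings on arbitrary types\<close>

lemma (in right_module) cyclic_rsubmodule:
  assumes x: "x \<in> carrier M"
  shows "rsubmodule R M {x \<star>\<^bsub>M\<^esub> r | r. r \<in> carrier R}"
proof (rule rsubmoduleI)
  show "\<zero>\<^bsub>M\<^esub> \<in> {x \<star>\<^bsub>M\<^esub> r | r. r \<in> carrier R}"
    using rsmult_zero_right[OF x] R.zero_closed by force
  show "u \<oplus>\<^bsub>M\<^esub> v \<in> {x \<star>\<^bsub>M\<^esub> r | r. r \<in> carrier R}"
    if "u \<in> {x \<star>\<^bsub>M\<^esub> r | r. r \<in> carrier R}" "v \<in> {x \<star>\<^bsub>M\<^esub> r | r. r \<in> carrier R}" for u v
    using that rsmult_add_right[OF x, symmetric] by auto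
  show "u \<star>\<^bsub>M\<^esub> s \<in> {x \<star>\<^bsub>M\<^esub> r | r. r \<in> carrier R}"
    if "u \<in> {x \<star>\<^bsub>M\<^esub> r | r. r \<in> carrier R}" "s \<in> carrier R" for u s
    using that rsmult_assoc[OF x, symmetric] by auto
qed (use x in auto)

lemma (in right_module) inj_on_annihilator_coset:
  "inj_on (\<lambda>y. {r \<in> carrier R. x \<star>\<^bsub>M\<^esub> r = y}) {x \<star>\<^bsub>M\<^esub> r | r. r \<in> carrier R}"
  by (rule inj_onI) blast

lemma (in right_module) rsubmodule_transport:
  fixes j :: "'b \<Rightarrow> 'c"
  assumes j: "inj_on j (carrier M)" and N: "N \<subseteq> carrier M"
  shows "rsubmodule R (transport_rmodule j M) (j ` N) \<longleftrightarrow> rsubmodule R M N"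
proof -
  note t = transport_simps[OF j]
  interpret T: right_module R "transport_rmodule j M" by (rule transport_right_module[OF j])
  have mem: "j x \<in> j ` N \<longleftrightarrow> x \<in> N" if "x \<in> carrier M" for x
    using inj_on_image_mem_iff[OF j that N] .
  show ?thesis
  proof
    assume "rsubmodule R (transport_rmodule j M) (j ` N)"
    note D = rsubmoduleD[OF this]
    show "rsubmodule R M N"
    proof (rule rsubmoduleI)
      show "\<zero>\<^bsub>M\<^esub> \<in> N" using D(2) mem by (simp add: t(2))
      show "x \<oplus>\<^bsub>M\<^esub> y \<in> N" if xy: "x \<in> N" "y \<in> N" for x y
      proof -
        have c: "x \<in> carrier M" "y \<in> carrier M" using xy N by auto
        show ?thesis using D(3)[of "j x" "j y"] xy c mem[of "x \<oplus>\<^bsub>M\<^esub> y"] by (simp add: t(3))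
      qed
      show "x \<star>\<^bsub>M\<^esub> r \<in> N" if xr: "x \<in> N" "r \<in> carrier R" for x r
      proof -
        have c: "x \<in> carrier M" using xr N by auto
        show ?thesis using D(4)[of "j x" r] xr c mem[of "x \<star>\<^bsub>M\<^esub> r"] by (simp add: t(4))
      qed
    qed (rule N)
  next
    assume "rsubmodule R M N"
    note D = rsubmoduleD[OF this]
    show "rsubmodule R (transport_rmodule j M) (j ` N)"
    proof (rule T.rsubmoduleI)
      show "j ` N \<subseteq> carrier (transport_rmodule j M)" using N by (auto simp: t(1))
      show "\<zero>\<^bsub>transport_rmodule j M\<^esub> \<in> j ` N" using D(2) by (simp add: t(2))
      show "x \<oplus>\<^bsub>transport_rmodule j M\<^esub> y \<in> j ` N" if "x \<in> j ` N" "y \<in> j ` N" for x y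
        using that D(3) N by (auto simp: t(3) subset_iff)
      show "x \<star>\<^bsub>transport_rmodule j M\<^esub> r \<in> j ` N" if "x \<in> j ` N" "r \<in> carrier R" for x r
        using that D(4) N by (auto simp: t(4) subset_iff)
    qed
  qed
qed

lemma rsubmodule_restrict:
  assumes "rsubmodule R M S" "right_module R M"
  shows "rsubmodule R (M\<lparr>carrier := S\<rparr>) N \<longleftrightarrow> rsubmodule R M N \<and> N \<subseteq> S"
proof -
  interpret M: right_module R M by fact
  interpret S: right_module R "M\<lparr>carrier := S\<rparr>" by (rule M.rsubmodule_right_module) fact
  show ?thesis
  proof
    assume N: "rsubmodule R (M\<lparr>carrier := S\<rparr>) N"
    note D = rsubmoduleD[OF N]
    have "rsubmodule R M N"
      by (rule M.rsubmoduleI) (use D rsubmoduleD(1)[OF assms(1)] in auto)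
    then show "rsubmodule R M N \<and> N \<subseteq> S" using D(1) by simp
  next
    assume N: "rsubmodule R M N \<and> N \<subseteq> S"
    then have "rsubmodule R M N" ..
    note D = rsubmoduleD[OF this]
    show "rsubmodule R (M\<lparr>carrier := S\<rparr>) N"
      by (rule S.rsubmoduleI) (use D N in auto)
  qed
qed

lemma (in right_module) simple_restrict_iff:
  assumes "rsubmodule R M S"
  shows "simple_rmodule R (M\<lparr>carrier := S\<rparr>) \<longleftrightarrow>
    S \<noteq> {\<zero>\<^bsub>M\<^esub>} \<and> (\<forall>N. rsubmodule R M N \<and> N \<subseteq> S \<longrightarrow> N = {\<zero>\<^bsub>M\<^esub>} \<or> N = S)"
  unfolding simple_rmodule_def
  using rsubmodule_right_module[OF assms] rsubmodule_restrict[OF assms right_module_axioms]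
  by simp

theorem right_semiartinian_any_type:
  fixes M :: "('a, 'b, 'm) rmodule_scheme"
  assumes R: "right_semiartinian R" and M: "right_module R M" "carrier M \<noteq> {\<zero>\<^bsub>M\<^esub>}"
  shows "\<exists>S. rsubmodule R M S \<and> simple_rmodule R (M\<lparr>carrier := S\<rparr>)"
proof -
  interpret M: right_module R M by fact
  obtain x where x: "x \<in> carrier M" "x \<noteq> \<zero>\<^bsub>M\<^esub>" using M(2) M.M.zero_closed by blast
  define X where "X = {x \<star>\<^bsub>M\<^esub> r | r. r \<in> carrier R}"
  have X: "rsubmodule R M X" unfolding X_def by (rule M.cyclic_rsubmodule[OF x(1)])
  interpret X: right_module R "M\<lparr>carrier := X\<rparr>" by (rule M.rsubmodule_right_module[OF X])
  define j where "j y = {r \<in> carrier R. x \<star>\<^bsub>M\<^esub> r = y}" for y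
  have j: "inj_on j (carrier (M\<lparr>carrier := X\<rparr>))"
    using M.inj_on_annihilator_coset[of x] by (simp add: j_def[abs_def] X_def)
  let ?T = "transport_rmodule j (M\<lparr>carrier := X\<rparr>)"
  interpret T: right_module R ?T by (rule X.transport_right_module[OF j])
  note t = X.transport_simps[OF j, simplified]
  have jX: "inj_on j X" and z: "\<zero>\<^bsub>M\<^esub> \<in> X" using j rsubmoduleD(2)[OF X] by simp_all
  have xX: "x \<in> X" unfolding X_def using M.rsmult_one[OF x(1)] M.R.one_closed by force
  have "j x \<noteq> j \<zero>\<^bsub>M\<^esub>" using inj_onD[OF jX _ xX z] x(2) by blast
  then have "carrier ?T \<noteq> {\<zero>\<^bsub>?T\<^esub>}" using xX by (auto simp: t)
  then obtain S' where S': "rsubmodule R ?T S'" "simple_rmodule R (?T\<lparr>carrier := S'\<rparr>)"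
    using R T.right_module_axioms unfolding right_semiartinian_def by blast
  obtain S where S: "S \<subseteq> X" "S' = j ` S"
    using rsubmoduleD(1)[OF S'(1)] unfolding t(1) by (auto simp: subset_image_iff)
  have tr: "rsubmodule R ?T (j ` N) \<longleftrightarrow> rsubmodule R M N" if "N \<subseteq> X" for N
    using X.rsubmodule_transport[OF j, of N] rsubmodule_restrict[OF X M(1), of N] that by simp
  have SM: "rsubmodule R M S" using tr[OF S(1)] S'(1) S(2) by simp
  have im: "j ` A = j ` B \<longleftrightarrow> A = B" if "A \<subseteq> X" "B \<subseteq> X" for A B
    using inj_on_image_eq_iff[OF jX that] .
  have simp': "S' \<noteq> {\<zero>\<^bsub>?T\<^esub>}" "\<And>N. rsubmodule R ?T N \<Longrightarrow> N \<subseteq> S' \<Longrightarrow> N = {\<zero>\<^bsub>?T\<^esub>} \<or> N = S'"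
    using S'(2) unfolding T.simple_restrict_iff[OF S'(1)] by auto
  have z': "{\<zero>\<^bsub>?T\<^esub>} = j ` {\<zero>\<^bsub>M\<^esub>}" by (simp add: t(2))
  have "simple_rmodule R (M\<lparr>carrier := S\<rparr>)"
    unfolding M.simple_restrict_iff[OF SM]
  proof (intro conjI allI impI)
    show "S \<noteq> {\<zero>\<^bsub>M\<^esub>}" using simp'(1) S(2) z' by auto
    fix N assume N: "rsubmodule R M N \<and> N \<subseteq> S"
    then have NX: "N \<subseteq> X" using S(1) by blast
    have "rsubmodule R ?T (j ` N)" "j ` N \<subseteq> S'" using N tr[OF NX] S(2) by auto
    from simp'(2)[OF this] show "N = {\<zero>\<^bsub>M\<^esub>} \<or> N = S"
      unfolding S(2) z' using im[OF NX S(1)] im[OF NX, of "{\<zero>\<^bsub>M\<^esub>}"] z by simp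
  qed
  with SM show ?thesis by blast
qed

theorem right_V_ring_any_type:
  fixes S :: "('a, 'b, 'm) rmodule_scheme"
  assumes R: "right_V_ring R" and S: "simple_rmodule R S"
  shows "injective_rmodule R S"
proof -
  interpret S: right_module R S using S by (simp add: simple_rmodule_def)
  obtain x where x: "x \<in> carrier S" "x \<noteq> \<zero>\<^bsub>S\<^esub>"
    using S S.M.zero_closed unfolding simple_rmodule_def by blast
  define X where "X = {x \<star>\<^bsub>S\<^esub> r | r. r \<in> carrier R}"
  have "x \<in> X" unfolding X_def using S.rsmult_one[OF x(1)] S.R.one_closed by force
  then have X: "carrier S = X"
    using S S.cyclic_rsubmodule[OF x(1)] x(2) unfolding simple_rmodule_def X_def by blast
  define j where "j y = {r \<in> carrier R. x \<star>\<^bsub>S\<^esub> r = y}" for y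
  have j: "inj_on j (carrier S)"
    using S.inj_on_annihilator_coset[of x] unfolding X by (simp add: j_def[abs_def] X_def)
  let ?T = "transport_rmodule j S" and ?k = "the_inv_into (carrier S) j"
  interpret T: right_module R ?T by (rule S.transport_right_module[OF j])
  note t = S.transport_simps[OF j]
  have z: "{\<zero>\<^bsub>?T\<^esub>} = j ` {\<zero>\<^bsub>S\<^esub>}" by (simp add: t(2))
  have "simple_rmodule R ?T"
    unfolding simple_rmodule_def
  proof (intro conjI allI impI)
    show "right_module R ?T" by (rule T.right_module_axioms)
    show "carrier ?T \<noteq> {\<zero>\<^bsub>?T\<^esub>}"
      using S inj_on_image_eq_iff[OF j, of "carrier S" "{\<zero>\<^bsub>S\<^esub>}"]
      unfolding z t(1) simple_rmodule_def by auto
    fix N' assume N': "rsubmodule R ?T N'"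
    obtain N where N: "N \<subseteq> carrier S" "N' = j ` N"
      using rsubmoduleD(1)[OF N'] unfolding t(1) by (auto simp: subset_image_iff)
    then have "rsubmodule R S N" using S.rsubmodule_transport[OF j N(1)] N' by simp
    then have "N = {\<zero>\<^bsub>S\<^esub>} \<or> N = carrier S" using S unfolding simple_rmodule_def by blast
    then show "N' = {\<zero>\<^bsub>?T\<^esub>} \<or> N' = carrier ?T" unfolding z t(1) N(2) by blast
  qed
  then have inj: "injective_rmodule R ?T" using R by (simp add: right_V_ring_def)
  show ?thesis
    unfolding injective_rmodule_def
  proof (intro conjI allI impI ballI)
    show "right_module R S" by (rule S.right_module_axioms)
    fix A B :: "('a, 'b \<Rightarrow> 'a) rmodule" and i f
    assume AB: "right_module R A \<and> right_module R B"
      and i: "i \<in> rmodule_hom R A B" "inj_on i (carrier A)" and f: "f \<in> rmodule_hom R A S"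
    obtain h where h: "h \<in> rmodule_hom R B ?T" "\<And>a. a \<in> carrier A \<Longrightarrow> h (i a) = j (f a)"
      using injective_rmodule_extends[OF inj _ _ i rmodule_hom_compose[OF f S.transport_hom[OF j]]]
        AB by blast
    show "\<exists>h\<in>rmodule_hom R B S. \<forall>a\<in>carrier A. h (i a) = f a"
    proof (intro bexI ballI)
      show "(\<lambda>b. ?k (h b)) \<in> rmodule_hom R B S"
        by (rule rmodule_hom_compose[OF h(1) S.transport_hom_inv[OF j]])
      show "?k (h (i a)) = f a" if "a \<in> carrier A" for a
        using h(2)[OF that] the_inv_into_f_f[OF j rmodule_homD(1)[OF f that]] by simp
    qed
  qed
qed

end

theory Submission
  imports Defs
begin

text \<open>
  Let \<open>S\<close> be the right socle of \<open>R\<close>. As \<open>R\<close> is not semisimple, \<open>S \<noteq> R\<close>, and since \<open>R/S\<close> has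
  a simple submodule there is \<open>x \<notin> S\<close> such that \<open>J = xR\<close> satisfies: \<open>J/(J \<inter> S)\<close> is simple
  (\<open>exists_generator_over_socle\<close>). Simple right ideals are injective, so they can be split off \<open>J\<close>
  one after the other, and this never stops because \<open>J\<close> is not contained in \<open>S\<close>. Collecting the
  pieces alternately in two infinite direct sums and enlarging the first one yields a decomposition
  \<open>J \<inter> S = A \<oplus> B\<close> in which neither \<open>A\<close> nor \<open>B\<close> is a direct summand of \<open>J\<close>, since summands of
  the cyclic module \<open>J\<close> are cyclic while a strictly increasing union of submodules is not
  (\<open>socle_part_is_sum_of_nonsummands\<close>).

  The module without the required decomposition is \<open>J/A\<close>. Let \<open>V = K/A\<close> be a simple submodule.
  If \<open>K \<inter> B = 0\<close>, then \<open>K\<close> is not contained in \<open>S\<close>, hence \<open>K + (J \<inter> S) = J\<close>, and \<open>K\<close> is a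
  complement of \<open>B\<close> in \<open>J\<close>, which is excluded. So \<open>V\<close> is isomorphic to the right ideal
  \<open>K \<inter> B\<close> (\<open>simple_submodule_of_quotient\<close>). Being also injective, \<open>V\<close> is projective: by Baer's
  criterion the isomorphism \<open>K \<inter> B \<rightarrow> V\<close> extends to \<open>R\<close>, so \<open>V\<close> is a retract of \<open>R\<close>
  (\<open>injective_iso_right_ideal_projective\<close>).

  Now suppose \<open>J/A = P \<oplus> N\<close> with \<open>P\<close> projective and \<open>N\<close> stable. If \<open>N \<noteq> 0\<close>, it has a simple
  submodule, which is injective, hence a summand of \<open>N\<close>, and projective; this contradicts
  stability. If \<open>N = 0\<close>, then \<open>J/A\<close> is projective and \<open>A\<close> is a summand of \<open>J\<close>, a contradiction.
\<close>

section \<open>Sums and summands of submodules\<close>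

lemma mem_set_add_iff: "z \<in> A <+>\<^bsub>M\<^esub> B \<longleftrightarrow> (\<exists>a\<in>A. \<exists>b\<in>B. z = a \<oplus>\<^bsub>M\<^esub> b)"
  by (auto simp: set_add_def')

lemma set_add_restrict: "A <+>\<^bsub>M\<lparr>carrier := J\<rparr>\<^esub> B = A <+>\<^bsub>M\<^esub> B"
  by (simp add: set_add_def')

context right_module begin

lemma rsubmodule_minus:
  assumes "rsubmodule R M N" "x \<in> N" shows "\<ominus>\<^bsub>M\<^esub> x \<in> N"
  using rsubmoduleD(4)[OF assms, of "\<ominus>\<^bsub>R\<^esub> \<one>\<^bsub>R\<^esub>"] rsubmoduleD(1)[OF assms(1)] assms(2)
    rsmult_minus_one[of x] by (simp add: subset_iff)

lemma rsubmodule_diff: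
  assumes "rsubmodule R M N" "x \<in> N" "y \<in> N" shows "x \<ominus>\<^bsub>M\<^esub> y \<in> N"
  using rsubmoduleD(3)[OF assms(1,2) rsubmodule_minus[OF assms(1,3)]] by (simp add: M.minus_eq)

lemma add_eq_imp_eq_diff:
  assumes "x \<in> carrier M" "y \<in> carrier M" "x \<oplus>\<^bsub>M\<^esub> y = z"
  shows "x = z \<ominus>\<^bsub>M\<^esub> y" "y = z \<ominus>\<^bsub>M\<^esub> x"
proof -
  have *: "x = (x \<oplus>\<^bsub>M\<^esub> y) \<ominus>\<^bsub>M\<^esub> y" if "x \<in> carrier M" "y \<in> carrier M" for x y
    using that by (simp add: M.minus_eq M.a_assoc M.r_neg)
  show "x = z \<ominus>\<^bsub>M\<^esub> y" "y = z \<ominus>\<^bsub>M\<^esub> x"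
    using *[OF assms(1,2)] *[OF assms(2,1)] assms by (simp_all add: M.a_comm)
qed

lemma diff_eq_zero_iff:
  assumes "x \<in> carrier M" "y \<in> carrier M"
  shows "x \<ominus>\<^bsub>M\<^esub> y = \<zero>\<^bsub>M\<^esub> \<longleftrightarrow> x = y"
  using assms by (metis M.minus_eq M.r_neg M.add.inv_equality M.minus_minus M.a_inv_closed)

lemma eq_add_diff:
  assumes "x \<in> carrier M" "y \<in> carrier M" shows "x = y \<oplus>\<^bsub>M\<^esub> (x \<ominus>\<^bsub>M\<^esub> y)"
proof -
  have "x = (x \<ominus>\<^bsub>M\<^esub> y) \<oplus>\<^bsub>M\<^esub> y" using assms by (simp add: M.minus_eq M.a_assoc M.l_neg)
  then show ?thesis using assms M.a_comm[of "x \<ominus>\<^bsub>M\<^esub> y" y] by simp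
qed

lemma rsubmodule_cancel:
  assumes "rsubmodule R M N" "x \<in> carrier M" "y \<in> carrier M" "x \<oplus>\<^bsub>M\<^esub> y \<in> N"
  shows "x \<in> N \<longleftrightarrow> y \<in> N"
  using rsubmodule_diff[OF assms(1,4)] add_eq_imp_eq_diff[OF assms(2,3) refl] by metis

lemma rsubmodule_set_add:
  assumes "rsubmodule R M A" "rsubmodule R M B"
  shows "rsubmodule R M (A <+>\<^bsub>M\<^esub> B)"
proof -
  note A = rsubmoduleD[OF assms(1)] and B = rsubmoduleD[OF assms(2)]
  show ?thesis
  proof (rule rsubmoduleI)
    show "A <+>\<^bsub>M\<^esub> B \<subseteq> carrier M" using A(1) B(1) by (fastforce simp: mem_set_add_iff)
    show "\<zero>\<^bsub>M\<^esub> \<in> A <+>\<^bsub>M\<^esub> B" using A(2) B(2) unfolding mem_set_add_iff by force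
    fix x y assume "x \<in> A <+>\<^bsub>M\<^esub> B" "y \<in> A <+>\<^bsub>M\<^esub> B"
    then obtain a b a' b' where *: "a \<in> A" "b \<in> B" "a' \<in> A" "b' \<in> B"
      "x = a \<oplus>\<^bsub>M\<^esub> b" "y = a' \<oplus>\<^bsub>M\<^esub> b'" unfolding mem_set_add_iff by blast
    moreover from this have "a \<in> carrier M" "a' \<in> carrier M" "b \<in> carrier M" "b' \<in> carrier M"
      using A(1) B(1) by blast+
    ultimately have "x \<oplus>\<^bsub>M\<^esub> y = (a \<oplus>\<^bsub>M\<^esub> a') \<oplus>\<^bsub>M\<^esub> (b \<oplus>\<^bsub>M\<^esub> b')"
      by (simp add: M.a_ac)
    then show "x \<oplus>\<^bsub>M\<^esub> y \<in> A <+>\<^bsub>M\<^esub> B" using * A(3) B(3) unfolding mem_set_add_iff by blast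
  next
    fix x r assume "x \<in> A <+>\<^bsub>M\<^esub> B" and r: "r \<in> carrier R"
    then obtain a b where *: "a \<in> A" "b \<in> B" "x = a \<oplus>\<^bsub>M\<^esub> b" unfolding mem_set_add_iff by blast
    moreover from this have "a \<in> carrier M" "b \<in> carrier M" using A(1) B(1) by blast+
    ultimately have "x \<star>\<^bsub>M\<^esub> r = a \<star>\<^bsub>M\<^esub> r \<oplus>\<^bsub>M\<^esub> b \<star>\<^bsub>M\<^esub> r" using r by (simp add: rsmult_add_left)
    then show "x \<star>\<^bsub>M\<^esub> r \<in> A <+>\<^bsub>M\<^esub> B"
      using A(4)[OF *(1) r] B(4)[OF *(2) r] unfolding mem_set_add_iff by blast
  qed
qed

lemma set_add_upper:
  assumes "rsubmodule R M A" "rsubmodule R M B"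
  shows "A \<subseteq> A <+>\<^bsub>M\<^esub> B" "B \<subseteq> A <+>\<^bsub>M\<^esub> B"
proof -
  note A = rsubmoduleD[OF assms(1)] and B = rsubmoduleD[OF assms(2)]
  show "A \<subseteq> A <+>\<^bsub>M\<^esub> B" using A(1) B(2) unfolding subset_iff mem_set_add_iff by (metis M.r_zero)
  show "B \<subseteq> A <+>\<^bsub>M\<^esub> B" using B(1) A(2) unfolding subset_iff mem_set_add_iff by (metis M.l_zero)
qed

lemma set_add_least:
  assumes "rsubmodule R M C" "A \<subseteq> C" "B \<subseteq> C" shows "A <+>\<^bsub>M\<^esub> B \<subseteq> C"
  using assms(2,3) rsubmoduleD(3)[OF assms(1)] by (fastforce simp: mem_set_add_iff)

lemma rsubmodule_Int:
  assumes "rsubmodule R M A" "rsubmodule R M B" shows "rsubmodule R M (A \<inter> B)"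
  using rsubmoduleD[OF assms(1)] rsubmoduleD[OF assms(2)] by (intro rsubmoduleI) auto

lemma rsubmodule_Inter:
  assumes "\<C> \<noteq> {}" and sub: "\<And>N. N \<in> \<C> \<Longrightarrow> rsubmodule R M N"
  shows "rsubmodule R M (\<Inter>\<C>)"
proof (rule rsubmoduleI)
  note D = rsubmoduleD[OF sub]
  show "\<Inter>\<C> \<subseteq> carrier M" using assms(1) D(1) by blast
  show "\<zero>\<^bsub>M\<^esub> \<in> \<Inter>\<C>" by (rule InterI) (rule D(2))
  show "x \<oplus>\<^bsub>M\<^esub> y \<in> \<Inter>\<C>" if "x \<in> \<Inter>\<C>" "y \<in> \<Inter>\<C>" for x y
    by (rule InterI) (use that D(3) in auto)
  show "x \<star>\<^bsub>M\<^esub> r \<in> \<Inter>\<C>" if "x \<in> \<Inter>\<C>" "r \<in> carrier R" for x r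
    by (rule InterI) (use that D(4) in auto)
qed

lemma rsubmodule_zero: "rsubmodule R M {\<zero>\<^bsub>M\<^esub>}"
  by (rule rsubmoduleI) auto

lemma rsubmodule_carrier: "rsubmodule R M (carrier M)"
  by (rule rsubmoduleI) auto

lemma rsubmodule_chain_Union:
  assumes "\<C> \<noteq> {}" and sub: "\<And>N. N \<in> \<C> \<Longrightarrow> rsubmodule R M N"
    and chain: "\<And>A B. \<lbrakk>A \<in> \<C>; B \<in> \<C>\<rbrakk> \<Longrightarrow> A \<subseteq> B \<or> B \<subseteq> A"
  shows "rsubmodule R M (\<Union>\<C>)"
proof (rule rsubmoduleI)
  show "\<Union>\<C> \<subseteq> carrier M" using rsubmoduleD(1)[OF sub] by blast
  show "\<zero>\<^bsub>M\<^esub> \<in> \<Union>\<C>" using assms(1) rsubmoduleD(2)[OF sub] by blast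
  show "x \<star>\<^bsub>M\<^esub> r \<in> \<Union>\<C>" if "x \<in> \<Union>\<C>" "r \<in> carrier R" for x r
    using that rsubmoduleD(4)[OF sub] by blast
  fix x y assume "x \<in> \<Union>\<C>" "y \<in> \<Union>\<C>"
  then obtain N where "N \<in> \<C>" "x \<in> N" "y \<in> N" using chain by blast
  then show "x \<oplus>\<^bsub>M\<^esub> y \<in> \<Union>\<C>" using rsubmoduleD(3)[OF sub] by blast
qed

lemma direct_summand_restrict_iff:
  assumes J: "rsubmodule R M J"
  shows "direct_summand R (M\<lparr>carrier := J\<rparr>) A \<longleftrightarrow>
    rsubmodule R M A \<and> A \<subseteq> J \<and>
    (\<exists>K. rsubmodule R M K \<and> K \<subseteq> J \<and> J \<subseteq> A <+>\<^bsub>M\<^esub> K \<and> A \<inter> K = {\<zero>\<^bsub>M\<^esub>})"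
proof -
  have "A <+>\<^bsub>M\<^esub> K = J \<longleftrightarrow> J \<subseteq> A <+>\<^bsub>M\<^esub> K" if "A \<subseteq> J" "K \<subseteq> J" for K
    using set_add_least[OF J that] by blast
  then show ?thesis
    unfolding direct_summand_def internal_direct_sum_def
      rsubmodule_restrict[OF J right_module_axioms] set_add_restrict by auto
qed

text \<open>The component of a generator in a summand generates that summand.\<close>

lemma direct_summand_of_cyclic:
  assumes x: "x \<in> carrier M" and J: "J = {x \<star>\<^bsub>M\<^esub> r | r. r \<in> carrier R}"
    and A: "direct_summand R (M\<lparr>carrier := J\<rparr>) A"
  obtains a where "a \<in> A" "A = {a \<star>\<^bsub>M\<^esub> r | r. r \<in> carrier R}"
proof -
  have subJ: "rsubmodule R M J" unfolding J by (rule cyclic_rsubmodule[OF x])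
  obtain K where K: "rsubmodule R M K" "J \<subseteq> A <+>\<^bsub>M\<^esub> K" "A \<inter> K = {\<zero>\<^bsub>M\<^esub>}"
    and A': "rsubmodule R M A" "A \<subseteq> J"
    using A unfolding direct_summand_restrict_iff[OF subJ] by blast
  have "x \<in> J" unfolding J using rsmult_one[OF x] R.one_closed by force
  then obtain a k where ak: "a \<in> A" "k \<in> K" "x = a \<oplus>\<^bsub>M\<^esub> k"
    using K(2) mem_set_add_iff[of x M A K] by blast
  have c: "a \<in> carrier M" "k \<in> carrier M"
    using ak rsubmoduleD(1)[OF A'(1)] rsubmoduleD(1)[OF K(1)] by auto
  have "y \<in> {a \<star>\<^bsub>M\<^esub> r | r. r \<in> carrier R}" if y: "y \<in> A" for y
  proof -
    obtain r where r: "r \<in> carrier R" "y = x \<star>\<^bsub>M\<^esub> r" using y A'(2) unfolding J by blast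
    have y': "y = a \<star>\<^bsub>M\<^esub> r \<oplus>\<^bsub>M\<^esub> k \<star>\<^bsub>M\<^esub> r" using r ak c by (simp add: rsmult_add_left)
    have "a \<star>\<^bsub>M\<^esub> r \<in> A" "k \<star>\<^bsub>M\<^esub> r \<in> K"
      using rsubmoduleD(4)[OF A'(1) ak(1) r(1)] rsubmoduleD(4)[OF K(1) ak(2) r(1)] by simp_all
    moreover from this have "k \<star>\<^bsub>M\<^esub> r \<in> A"
      using rsubmodule_cancel[OF A'(1), of "a \<star>\<^bsub>M\<^esub> r" "k \<star>\<^bsub>M\<^esub> r"] y y' c r by simp
    ultimately have "k \<star>\<^bsub>M\<^esub> r = \<zero>\<^bsub>M\<^esub>" using K(3) by blast
    then show ?thesis using y' c r by auto
  qed
  moreover have "{a \<star>\<^bsub>M\<^esub> r | r. r \<in> carrier R} \<subseteq> A"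
    using rsubmoduleD(4)[OF A'(1) ak(1)] by blast
  ultimately show thesis using that[of a] ak(1) by blast
qed

text \<open>A generator of the union would already lie in some \<open>E n\<close>, and the chain would stop there.\<close>

lemma chain_Union_not_direct_summand:
  fixes E :: "nat \<Rightarrow> 'b set"
  assumes x: "x \<in> carrier M" and J: "J = {x \<star>\<^bsub>M\<^esub> r | r. r \<in> carrier R}"
    and E: "\<And>n. rsubmodule R M (E n)" "\<And>n. E n \<subset> E (Suc n)"
  shows "\<not> direct_summand R (M\<lparr>carrier := J\<rparr>) (\<Union>n. E n)"
proof
  assume "direct_summand R (M\<lparr>carrier := J\<rparr>) (\<Union>n. E n)"
  then obtain a where a: "a \<in> (\<Union>n. E n)" "(\<Union>n. E n) = {a \<star>\<^bsub>M\<^esub> r | r. r \<in> carrier R}"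
    by (rule direct_summand_of_cyclic[OF x J])
  from a(1) obtain n where "a \<in> E n" by blast
  then have "(\<Union>n. E n) \<subseteq> E n" using a(2) rsubmoduleD(4)[OF E(1)] by auto
  then show False using E(2)[of n] by blast
qed

end

section \<open>The socle\<close>

text \<open>
  The socle is the sum of the simple submodules, taken here as the least submodule containing
  them: an inclusion of the socle then needs to be tested on simple submodules only, without any
  infinite sums.
\<close>

definition socle :: "('a, 'r) ring_scheme \<Rightarrow> ('a, 'b, 'm) rmodule_scheme \<Rightarrow> 'b set" where
  "socle R M = \<Inter>{N. rsubmodule R M N \<and>
    (\<forall>T. rsubmodule R M T \<and> simple_rmodule R (M\<lparr>carrier := T\<rparr>) \<longrightarrow> T \<subseteq> N)}"

context right_module begin

lemma socle_least:
  assumes "rsubmodule R M N"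
    and "\<And>T. \<lbrakk>rsubmodule R M T; simple_rmodule R (M\<lparr>carrier := T\<rparr>)\<rbrakk> \<Longrightarrow> T \<subseteq> N"
  shows "socle R M \<subseteq> N"
  using assms unfolding socle_def by blast

lemma simple_subset_socle:
  assumes "rsubmodule R M T" "simple_rmodule R (M\<lparr>carrier := T\<rparr>)"
  shows "T \<subseteq> socle R M"
  using assms unfolding socle_def by blast

lemma rsubmodule_socle: "rsubmodule R M (socle R M)"
proof -
  let ?C = "{N. rsubmodule R M N \<and>
    (\<forall>T. rsubmodule R M T \<and> simple_rmodule R (M\<lparr>carrier := T\<rparr>) \<longrightarrow> T \<subseteq> N)}"
  have "carrier M \<in> ?C" using rsubmodule_carrier rsubmoduleD(1)[of R M] by blast
  then show ?thesis unfolding socle_def by (intro rsubmodule_Inter) blast+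
qed

lemma simple_Int_cases:
  assumes "rsubmodule R M T" "simple_rmodule R (M\<lparr>carrier := T\<rparr>)" "rsubmodule R M N"
  shows "T \<inter> N = {\<zero>\<^bsub>M\<^esub>} \<or> T \<subseteq> N"
  using assms(2) rsubmodule_Int[OF assms(1,3)] unfolding simple_restrict_iff[OF assms(1)] by blast

text \<open>
  By Zorn's lemma there is a maximal \<open>D \<supseteq> D0\<close> with \<open>N \<inter> D = 0\<close>. A simple submodule \<open>T\<close> outside
  \<open>N + D\<close> would be independent of \<open>N + D\<close>, and \<open>D + T\<close> would contradict maximality.
\<close>

lemma complement_in_socle:
  assumes N: "rsubmodule R M N" and D0: "rsubmodule R M D0" "N \<inter> D0 = {\<zero>\<^bsub>M\<^esub>}"
  obtains D where "rsubmodule R M D" "D0 \<subseteq> D" "N \<inter> D = {\<zero>\<^bsub>M\<^esub>}" "socle R M \<subseteq> N <+>\<^bsub>M\<^esub> D"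
proof -
  define Z where "Z = {D. rsubmodule R M D \<and> D0 \<subseteq> D \<and> N \<inter> D = {\<zero>\<^bsub>M\<^esub>}}"
  have "\<exists>D\<in>Z. \<forall>X\<in>Z. D \<subseteq> X \<longrightarrow> X = D"
  proof (rule subset_Zorn_nonempty)
    show "Z \<noteq> {}" using D0 unfolding Z_def by blast
    fix \<C> assume C: "\<C> \<noteq> {}" "subset.chain Z \<C>"
    then have sub: "\<And>X. X \<in> \<C> \<Longrightarrow> X \<in> Z" by (auto simp: subset_chain_def)
    then have sub': "\<And>X. X \<in> \<C> \<Longrightarrow> rsubmodule R M X" "\<And>X. X \<in> \<C> \<Longrightarrow> D0 \<subseteq> X"
      "\<And>X. X \<in> \<C> \<Longrightarrow> N \<inter> X = {\<zero>\<^bsub>M\<^esub>}" unfolding Z_def by blast+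
    have "rsubmodule R M (\<Union>\<C>)"
      by (rule rsubmodule_chain_Union[OF C(1) sub'(1)]) (use C(2) in \<open>simp_all add: subset_chain_def\<close>)
    moreover have "D0 \<subseteq> \<Union>\<C>" "N \<inter> \<Union>\<C> = {\<zero>\<^bsub>M\<^esub>}" using C(1) sub'(2,3) by blast+
    ultimately show "\<Union>\<C> \<in> Z" unfolding Z_def by blast
  qed
  then obtain D where DZ: "D \<in> Z" and max: "\<And>X. X \<in> Z \<Longrightarrow> D \<subseteq> X \<Longrightarrow> X = D" by blast
  from DZ have D: "rsubmodule R M D" "D0 \<subseteq> D" "N \<inter> D = {\<zero>\<^bsub>M\<^esub>}" unfolding Z_def by blast+
  note ND = rsubmodule_set_add[OF N D(1)]
  have "T \<subseteq> N <+>\<^bsub>M\<^esub> D" if T: "rsubmodule R M T" "simple_rmodule R (M\<lparr>carrier := T\<rparr>)" for T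
  proof (rule ccontr)
    assume no: "\<not> T \<subseteq> N <+>\<^bsub>M\<^esub> D"
    then have T0: "T \<inter> (N <+>\<^bsub>M\<^esub> D) = {\<zero>\<^bsub>M\<^esub>}" using simple_Int_cases[OF T ND] by blast
    note DT = rsubmodule_set_add[OF D(1) T(1)]
    have "z = \<zero>\<^bsub>M\<^esub>" if z: "z \<in> N" "z \<in> D <+>\<^bsub>M\<^esub> T" for z
    proof -
      obtain d t where dt: "d \<in> D" "t \<in> T" "z = d \<oplus>\<^bsub>M\<^esub> t" using z by (auto simp: mem_set_add_iff)
      have c: "d \<in> carrier M" "t \<in> carrier M"
        using dt rsubmoduleD(1)[OF D(1)] rsubmoduleD(1)[OF T(1)] by auto
      have "d \<in> N <+>\<^bsub>M\<^esub> D" "z \<in> N <+>\<^bsub>M\<^esub> D" using dt z set_add_upper[OF N D(1)] by auto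
      then have "t \<in> N <+>\<^bsub>M\<^esub> D" using rsubmodule_cancel[OF ND c] dt(3) by simp
      then have "t = \<zero>\<^bsub>M\<^esub>" using T0 dt(2) by blast
      then show ?thesis using dt c z D(3) by auto
    qed
    then have "N \<inter> (D <+>\<^bsub>M\<^esub> T) = {\<zero>\<^bsub>M\<^esub>}" using rsubmoduleD(2)[OF N] rsubmoduleD(2)[OF DT] by blast
    then have "D <+>\<^bsub>M\<^esub> T \<in> Z" using DT D(2) set_add_upper[OF D(1) T(1)] unfolding Z_def by blast
    then have "T \<subseteq> D" using max set_add_upper[OF D(1) T(1)] by blast
    then show False using no set_add_upper[OF N D(1)] by blast
  qed
  then have "socle R M \<subseteq> N <+>\<^bsub>M\<^esub> D" by (rule socle_least[OF ND])
  with D that show thesis by blast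
qed

lemma semisimple_if_socle_eq_carrier:
  assumes "socle R M = carrier M" shows "semisimple_rmodule R M"
  unfolding semisimple_rmodule_def
proof (intro conjI allI impI right_module_axioms)
  fix N assume N: "rsubmodule R M N"
  have "N \<inter> {\<zero>\<^bsub>M\<^esub>} = {\<zero>\<^bsub>M\<^esub>}" using rsubmoduleD(2)[OF N] by blast
  then obtain D where D: "rsubmodule R M D" "N \<inter> D = {\<zero>\<^bsub>M\<^esub>}" "socle R M \<subseteq> N <+>\<^bsub>M\<^esub> D"
    by (rule complement_in_socle[OF N rsubmodule_zero])
  then have "N <+>\<^bsub>M\<^esub> D = carrier M"
    using assms rsubmoduleD(1)[OF rsubmodule_set_add[OF N D(1)]] by blast
  then show "direct_summand R M N"
    using N D unfolding direct_summand_def internal_direct_sum_def by blast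
qed

end

section \<open>Homomorphisms, injectivity and projectivity\<close>

lemma rsubmodule_hom_image:
  assumes M: "right_module R M" and Q: "right_module R Q" and f: "f \<in> rmodule_hom R M Q"
    and N: "rsubmodule R M N"
  shows "rsubmodule R Q (f ` N)"
proof -
  interpret M: right_module R M by fact
  interpret Q: right_module R Q by fact
  note N' = rsubmoduleD[OF N] and f' = rmodule_homD[OF f]
  show ?thesis
  proof (rule Q.rsubmoduleI)
    show "f ` N \<subseteq> carrier Q" using N'(1) f'(1) by blast
    show "\<zero>\<^bsub>Q\<^esub> \<in> f ` N" using N'(2) rmodule_hom_zero[OF M Q f] by force
    fix x y assume "x \<in> f ` N" "y \<in> f ` N"
    then obtain a b where "a \<in> N" "b \<in> N" "x = f a" "y = f b" by blast
    moreover from this have "f (a \<oplus>\<^bsub>M\<^esub> b) = x \<oplus>\<^bsub>Q\<^esub> y" using N'(1) f'(2) by blast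
    ultimately show "x \<oplus>\<^bsub>Q\<^esub> y \<in> f ` N" using N'(3) by (metis imageI)
  next
    fix x r assume "x \<in> f ` N" and r: "r \<in> carrier R"
    then obtain a where "a \<in> N" "x = f a" by blast
    moreover from this have "f (a \<star>\<^bsub>M\<^esub> r) = x \<star>\<^bsub>Q\<^esub> r" using N'(1) f'(3) r by blast
    ultimately show "x \<star>\<^bsub>Q\<^esub> r \<in> f ` N" using N'(4) r by (metis imageI)
  qed
qed

lemma rsubmodule_hom_vimage:
  assumes M: "right_module R M" and Q: "right_module R Q" and f: "f \<in> rmodule_hom R M Q"
    and N: "rsubmodule R Q N"
  shows "rsubmodule R M {x \<in> carrier M. f x \<in> N}"
proof -
  interpret M: right_module R M by fact
  interpret Q: right_module R Q by fact
  show ?thesis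
    by (rule M.rsubmoduleI)
      (use rsubmoduleD[OF N] rmodule_homD[OF f] rmodule_hom_zero[OF M Q f] in auto)
qed

lemma hom_diff:
  assumes M: "right_module R M" and Q: "right_module R Q" and f: "f \<in> rmodule_hom R M Q"
    and "x \<in> carrier M" "y \<in> carrier M"
  shows "f (x \<ominus>\<^bsub>M\<^esub> y) = f x \<ominus>\<^bsub>Q\<^esub> f y"
proof -
  interpret M: right_module R M by fact
  interpret Q: right_module R Q by fact
  note f' = rmodule_homD[OF f]
  have "f (x \<ominus>\<^bsub>M\<^esub> y) = f (x \<oplus>\<^bsub>M\<^esub> y \<star>\<^bsub>M\<^esub> (\<ominus>\<^bsub>R\<^esub> \<one>\<^bsub>R\<^esub>))"
    using assms(4,5) by (simp add: M.rsmult_minus_one M.M.minus_eq)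
  also have "\<dots> = f x \<ominus>\<^bsub>Q\<^esub> f y"
    using assms(4,5) by (simp add: f' Q.rsmult_minus_one Q.M.minus_eq)
  finally show ?thesis .
qed

lemma hom_eq_iff_diff:
  assumes M: "right_module R M" and Q: "right_module R Q" and f: "f \<in> rmodule_hom R M Q"
    and "x \<in> carrier M" "y \<in> carrier M"
  shows "f x = f y \<longleftrightarrow> f (x \<ominus>\<^bsub>M\<^esub> y) = \<zero>\<^bsub>Q\<^esub>"
proof -
  interpret Q: right_module R Q by fact
  show ?thesis
    using hom_diff[OF assms] rmodule_homD(1)[OF f] assms(4,5) by (simp add: Q.diff_eq_zero_iff)
qed

lemma (in right_module) rmodule_hom_inclusion:
  assumes "A \<subseteq> B" shows "(\<lambda>x. x) \<in> rmodule_hom R (M\<lparr>carrier := A\<rparr>) (M\<lparr>carrier := B\<rparr>)"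
  using assms by (auto simp: rmodule_hom_def)

text \<open>The complement is the kernel of an extension of the identity of \<open>E\<close> to \<open>J\<close>.\<close>

lemma (in right_module) injective_direct_summand:
  assumes J: "rsubmodule R M J" and E: "rsubmodule R M E" "E \<subseteq> J"
    and inj: "injective_rmodule R (M\<lparr>carrier := E\<rparr>)"
  shows "direct_summand R (M\<lparr>carrier := J\<rparr>) E"
proof -
  note mE = rsubmodule_right_module[OF E(1)] and mJ = rsubmodule_right_module[OF J]
  interpret J: right_module R "M\<lparr>carrier := J\<rparr>" by (rule mJ)
  have "\<exists>h\<in>rmodule_hom R (M\<lparr>carrier := J\<rparr>) (M\<lparr>carrier := E\<rparr>). \<forall>x\<in>carrier (M\<lparr>carrier := E\<rparr>). h x = x"
    by (rule injective_rmodule_extends[OF inj mE mJ rmodule_hom_inclusion[OF E(2)] _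
          rmodule_hom_inclusion[OF subset_refl]]) simp
  then obtain h where h: "h \<in> rmodule_hom R (M\<lparr>carrier := J\<rparr>) (M\<lparr>carrier := E\<rparr>)"
    "\<And>x. x \<in> E \<Longrightarrow> h x = x" by auto
  define K where "K = {x \<in> J. h x = \<zero>\<^bsub>M\<^esub>}"
  have E0: "rsubmodule R (M\<lparr>carrier := E\<rparr>) {\<zero>\<^bsub>M\<^esub>}"
    using rsubmodule_restrict[OF E(1) right_module_axioms] rsubmodule_zero rsubmoduleD(2)[OF E(1)]
    by simp
  have "rsubmodule R (M\<lparr>carrier := J\<rparr>) K"
    using rsubmodule_hom_vimage[OF mJ mE h(1) E0] by (simp add: K_def)
  then have K: "rsubmodule R M K" "K \<subseteq> J"
    using rsubmodule_restrict[OF J right_module_axioms] by auto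
  have "x \<in> E <+>\<^bsub>M\<^esub> K" if x: "x \<in> J" for x
  proof -
    have hx: "h x \<in> E" using rmodule_homD(1)[OF h(1)] x by simp
    have c: "x \<in> carrier M" "h x \<in> carrier M"
      using x hx rsubmoduleD(1)[OF J] rsubmoduleD(1)[OF E(1)] by auto
    have d: "x \<ominus>\<^bsub>M\<^esub> h x \<in> J" using rsubmodule_diff[OF J x] hx E(2) by blast
    have s: "x = h x \<oplus>\<^bsub>M\<^esub> (x \<ominus>\<^bsub>M\<^esub> h x)" by (rule eq_add_diff[OF c])
    have "h x = h (h x) \<oplus>\<^bsub>M\<^esub> h (x \<ominus>\<^bsub>M\<^esub> h x)"
      using rmodule_homD(2)[OF h(1), of "h x" "x \<ominus>\<^bsub>M\<^esub> h x"] s d hx E(2) by auto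
    moreover have "h (x \<ominus>\<^bsub>M\<^esub> h x) \<in> carrier M"
      using rmodule_homD(1)[OF h(1)] d rsubmoduleD(1)[OF E(1)] by auto
    ultimately have "h (x \<ominus>\<^bsub>M\<^esub> h x) = \<zero>\<^bsub>M\<^esub>" using h(2)[OF hx] c by simp
    then show ?thesis using s hx d unfolding mem_set_add_iff K_def by blast
  qed
  moreover have "E \<inter> K = {\<zero>\<^bsub>M\<^esub>}"
    using h(2) rsubmoduleD(2)[OF E(1)] rsubmoduleD(2)[OF K(1)] unfolding K_def by auto
  ultimately show ?thesis unfolding direct_summand_restrict_iff[OF J] using E K by blast
qed

text \<open>The complement is the image of a section of \<open>q\<close>.\<close>

lemma kernel_direct_summand_if_projective:
  assumes M: "right_module R M" and Q: "projective_rmodule R Q"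
    and q: "q \<in> rmodule_hom R M Q" "q ` carrier M = carrier Q"
  shows "direct_summand R M {x \<in> carrier M. q x = \<zero>\<^bsub>Q\<^esub>}"
proof -
  have mQ: "right_module R Q" using Q by (simp add: projective_rmodule_def)
  interpret M: right_module R M by fact
  interpret Q: right_module R Q by fact
  let ?A = "{x \<in> carrier M. q x = \<zero>\<^bsub>Q\<^esub>}"
  have "(\<lambda>x. x) \<in> rmodule_hom R Q Q" by (auto simp: rmodule_hom_def)
  then obtain s where s: "s \<in> rmodule_hom R Q M" "\<And>y. y \<in> carrier Q \<Longrightarrow> q (s y) = y"
    using projective_rmodule_lifts[OF Q M mQ q] by blast
  have A: "rsubmodule R M ?A"
    using rsubmodule_hom_vimage[OF M mQ q(1) Q.rsubmodule_zero] by simp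
  have K: "rsubmodule R M (s ` carrier Q)"
    by (rule rsubmodule_hom_image[OF mQ M s(1) Q.rsubmodule_carrier])
  have "z = \<zero>\<^bsub>M\<^esub>" if z: "z \<in> ?A" "z \<in> s ` carrier Q" for z
  proof -
    obtain y where y: "y \<in> carrier Q" "z = s y" using z(2) by blast
    then have "y = \<zero>\<^bsub>Q\<^esub>" using z(1) s(2)[OF y(1)] by simp
    then show ?thesis using y(2) rmodule_hom_zero[OF mQ M s(1)] by simp
  qed
  then have "?A \<inter> s ` carrier Q = {\<zero>\<^bsub>M\<^esub>}"
    using rsubmoduleD(2)[OF A] rsubmoduleD(2)[OF K] by blast
  moreover have "x \<in> ?A <+>\<^bsub>M\<^esub> s ` carrier Q" if x: "x \<in> carrier M" for x
  proof -
    have y: "q x \<in> carrier Q" and sy: "s (q x) \<in> carrier M"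
      using x rmodule_homD(1)[OF q(1)] rmodule_homD(1)[OF s(1)] by auto
    have "q (x \<ominus>\<^bsub>M\<^esub> s (q x)) = \<zero>\<^bsub>Q\<^esub>"
      using hom_eq_iff_diff[OF M mQ q(1) x sy] s(2)[OF y] by simp
    then have "x \<ominus>\<^bsub>M\<^esub> s (q x) \<in> ?A" using x sy by simp
    moreover have "x = (x \<ominus>\<^bsub>M\<^esub> s (q x)) \<oplus>\<^bsub>M\<^esub> s (q x)"
      using x sy by (simp add: M.M.minus_eq M.M.a_assoc M.M.l_neg)
    ultimately show ?thesis using y unfolding mem_set_add_iff by blast
  qed
  ultimately show ?thesis
    using A K rsubmoduleD(1)[OF M.rsubmodule_set_add[OF A K]]
    unfolding direct_summand_def internal_direct_sum_def by blast
qed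

text \<open>
  Since \<open>r \<mapsto> e \<star> r\<close> is a retraction of \<open>R\<close> onto \<open>P\<close> with section \<open>s\<close>, a map \<open>f\<close> out of \<open>P\<close>
  is lifted by lifting the single element \<open>f e\<close> and composing with \<open>s\<close>.
\<close>

lemma projective_if_retract_of_regular:
  fixes P :: "('a, 'b, 'm) rmodule_scheme"
  assumes P: "right_module R P" and e: "e \<in> carrier P"
    and s: "s \<in> rmodule_hom R P (regular_rmodule R)" "\<And>p. p \<in> carrier P \<Longrightarrow> e \<star>\<^bsub>P\<^esub> s p = p"
  shows "projective_rmodule R P"
  unfolding projective_rmodule_def
proof (intro conjI allI impI ballI P)
  fix B C :: "('a, 'b \<Rightarrow> 'a) rmodule" and g f
  assume "right_module R B \<and> right_module R C" and g: "g \<in> rmodule_hom R B C"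
    and f: "f \<in> rmodule_hom R P C" and surj: "g ` carrier B = carrier C"
  then interpret B: right_module R B by blast
  have "f e \<in> g ` carrier B" using surj rmodule_homD(1)[OF f e] by simp
  then obtain b where b: "b \<in> carrier B" "g b = f e" by auto
  have sR: "s p \<in> carrier R" if "p \<in> carrier P" for p
    using rmodule_homD(1)[OF s(1) that] by (simp add: regular_rmodule_def)
  show "\<exists>h\<in>rmodule_hom R P B. \<forall>x\<in>carrier P. g (h x) = f x"
  proof (intro bexI ballI)
    show "(\<lambda>p. b \<star>\<^bsub>B\<^esub> s p) \<in> rmodule_hom R P B"
      using rmodule_homD(2,3)[OF s(1)] sR b(1)
      by (auto simp: rmodule_hom_def regular_rmodule_def B.rsmult_add_right B.rsmult_assoc)
    fix p assume p: "p \<in> carrier P"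
    show "g (b \<star>\<^bsub>B\<^esub> s p) = f p"
      using rmodule_homD(3)[OF g b(1) sR[OF p]] rmodule_homD(3)[OF f e sR[OF p]] s(2)[OF p] b(2)
      by simp
  qed
qed

text \<open>
  Injectivity of \<open>E\<close> extends the isomorphism \<open>f\<close> from the right ideal \<open>T\<close> to all of \<open>R\<close>, and
  the inverse of \<open>f\<close> is a section of this extension.
\<close>

lemma injective_iso_right_ideal_projective:
  assumes E: "injective_rmodule R E" and T: "rsubmodule R (regular_rmodule R) T"
    and f: "f \<in> rmodule_hom R ((regular_rmodule R)\<lparr>carrier := T\<rparr>) E"
      "bij_betw f T (carrier E)"
  shows "projective_rmodule R E"
proof -
  interpret E: right_module R E using E by (simp add: injective_rmodule_def)
  interpret RR: right_module R "regular_rmodule R"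
    by (rule regular_right_module) (rule E.R.ring_axioms)
  obtain e where e: "e \<in> carrier E" "\<And>r. r \<in> T \<Longrightarrow> f r = e \<star>\<^bsub>E\<^esub> r"
    using Baer_condition[OF E T f(1)] by blast
  note T' = rsubmoduleD[OF T] and f' = rmodule_homD[OF f(1), simplified]
  have inj: "inj_on f T" and im: "f ` T = carrier E" using f(2) by (auto simp: bij_betw_def)
  define s where "s = the_inv_into T f"
  have sT: "s p \<in> T" and fs: "f (s p) = p" if "p \<in> carrier E" for p
    using that the_inv_into_into[OF inj _ subset_refl] f_the_inv_into_f[OF inj] im
    by (auto simp: s_def)
  have s_eq: "s p = r" if "r \<in> T" "f r = p" for p r
    using the_inv_into_f_eq[OF inj that(2,1)] by (simp add: s_def)
  have "s \<in> rmodule_hom R E (regular_rmodule R)"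
    unfolding rmodule_hom_def
    using sT fs T' f'(2,3) by (auto intro!: s_eq)
  then show ?thesis
    by (rule projective_if_retract_of_regular[OF E.right_module_axioms e(1)])
      (use e(2) sT fs in simp)
qed

section \<open>Quotient modules\<close>

text \<open>
  The scalar multiplication takes a union over all representatives of a coset, which avoids choosing
  one of them; all the cosets in this union are equal.
\<close>

definition quotient_rmodule :: "('a, 'b, 'm) rmodule_scheme \<Rightarrow> 'b set \<Rightarrow> ('a, 'b set) rmodule" where
  "quotient_rmodule M A =
    \<lparr>carrier = (\<lambda>x. A +>\<^bsub>M\<^esub> x) ` carrier M, mult = undefined, one = undefined, zero = A,
     add = (\<lambda>X Y. X <+>\<^bsub>M\<^esub> Y), rsmult = (\<lambda>X r. \<Union>x\<in>X. A +>\<^bsub>M\<^esub> (x \<star>\<^bsub>M\<^esub> r))\<rparr>"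

context right_module begin

context fixes A assumes A: "rsubmodule R M A" begin

lemma coset_eq_iff:
  assumes "x \<in> carrier M" "y \<in> carrier M"
  shows "A +>\<^bsub>M\<^esub> x = A +>\<^bsub>M\<^esub> y \<longleftrightarrow> x \<ominus>\<^bsub>M\<^esub> y \<in> A"
proof
  have 0: "\<zero>\<^bsub>M\<^esub> \<in> A" by (rule rsubmoduleD(2)[OF A])
  assume "A +>\<^bsub>M\<^esub> x = A +>\<^bsub>M\<^esub> y"
  moreover have "x \<in> A +>\<^bsub>M\<^esub> x" using 0 assms(1) M.l_zero[of x] unfolding a_r_coset_def' by force
  ultimately obtain a where a: "a \<in> A" "x = a \<oplus>\<^bsub>M\<^esub> y" unfolding a_r_coset_def' by blast
  then show "x \<ominus>\<^bsub>M\<^esub> y \<in> A"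
    using add_eq_imp_eq_diff(1)[of a y x] rsubmoduleD(1)[OF A] assms by auto
next
  assume d: "x \<ominus>\<^bsub>M\<^esub> y \<in> A"
  have "A +>\<^bsub>M\<^esub> x \<subseteq> A +>\<^bsub>M\<^esub> y" if "x \<ominus>\<^bsub>M\<^esub> y \<in> A" "x \<in> carrier M" "y \<in> carrier M" for x y
  proof
    fix z assume "z \<in> A +>\<^bsub>M\<^esub> x"
    then obtain a where a: "a \<in> A" "z = a \<oplus>\<^bsub>M\<^esub> x" unfolding a_r_coset_def' by blast
    then have "z = (a \<oplus>\<^bsub>M\<^esub> (x \<ominus>\<^bsub>M\<^esub> y)) \<oplus>\<^bsub>M\<^esub> y"
      using that(2,3) rsubmoduleD(1)[OF A] by (auto simp: M.minus_eq M.a_assoc M.l_neg)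
    then show "z \<in> A +>\<^bsub>M\<^esub> y"
      using rsubmoduleD(3)[OF A a(1) that(1)] unfolding a_r_coset_def' by blast
  qed
  moreover have "y \<ominus>\<^bsub>M\<^esub> x \<in> A"
    using rsubmodule_minus[OF A d] assms by (simp add: M.minus_eq M.minus_add M.a_comm)
  ultimately show "A +>\<^bsub>M\<^esub> x = A +>\<^bsub>M\<^esub> y" using d assms by blast
qed

lemma quotient_simps:
  "carrier (quotient_rmodule M A) = (\<lambda>x. A +>\<^bsub>M\<^esub> x) ` carrier M"
  "\<zero>\<^bsub>quotient_rmodule M A\<^esub> = A +>\<^bsub>M\<^esub> \<zero>\<^bsub>M\<^esub>"
  "\<lbrakk>x \<in> carrier M; y \<in> carrier M\<rbrakk> \<Longrightarrow>
    (A +>\<^bsub>M\<^esub> x) \<oplus>\<^bsub>quotient_rmodule M A\<^esub> (A +>\<^bsub>M\<^esub> y) = A +>\<^bsub>M\<^esub> (x \<oplus>\<^bsub>M\<^esub> y)"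
  "\<lbrakk>x \<in> carrier M; r \<in> carrier R\<rbrakk> \<Longrightarrow>
    (A +>\<^bsub>M\<^esub> x) \<star>\<^bsub>quotient_rmodule M A\<^esub> r = A +>\<^bsub>M\<^esub> (x \<star>\<^bsub>M\<^esub> r)"
proof -
  note A' = rsubmoduleD[OF A]
  show "carrier (quotient_rmodule M A) = (\<lambda>x. A +>\<^bsub>M\<^esub> x) ` carrier M"
    by (simp add: quotient_rmodule_def)
  show "\<zero>\<^bsub>quotient_rmodule M A\<^esub> = A +>\<^bsub>M\<^esub> \<zero>\<^bsub>M\<^esub>"
    using A'(1) by (auto simp: quotient_rmodule_def a_r_coset_def' subset_iff)
  have "abelian_subgroup A M"
    using A M.abelian_group_axioms unfolding rsubmodule_def
    by (intro abelian_subgroupI3 additive_subgroup.intro) auto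
  then show "(A +>\<^bsub>M\<^esub> x) \<oplus>\<^bsub>quotient_rmodule M A\<^esub> (A +>\<^bsub>M\<^esub> y) = A +>\<^bsub>M\<^esub> (x \<oplus>\<^bsub>M\<^esub> y)"
    if "x \<in> carrier M" "y \<in> carrier M"
    using abelian_subgroup.a_rcos_sum that by (fastforce simp: quotient_rmodule_def)
  assume x: "x \<in> carrier M" and r: "r \<in> carrier R"
  have "A +>\<^bsub>M\<^esub> (y \<star>\<^bsub>M\<^esub> r) = A +>\<^bsub>M\<^esub> (x \<star>\<^bsub>M\<^esub> r)" if "y \<in> A +>\<^bsub>M\<^esub> x" for y
  proof -
    obtain a where a: "a \<in> A" "y = a \<oplus>\<^bsub>M\<^esub> x" using \<open>y \<in> A +>\<^bsub>M\<^esub> x\<close> unfolding a_r_coset_def' by blast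
    have c: "a \<in> carrier M" using a A'(1) by blast
    have ar: "a \<star>\<^bsub>M\<^esub> r \<in> A" using a r A'(4) by blast
    have "y \<star>\<^bsub>M\<^esub> r = a \<star>\<^bsub>M\<^esub> r \<oplus>\<^bsub>M\<^esub> x \<star>\<^bsub>M\<^esub> r" using a c x r by (simp add: rsmult_add_left)
    then have "a \<star>\<^bsub>M\<^esub> r = y \<star>\<^bsub>M\<^esub> r \<ominus>\<^bsub>M\<^esub> x \<star>\<^bsub>M\<^esub> r"
      using add_eq_imp_eq_diff(1)[of "a \<star>\<^bsub>M\<^esub> r" "x \<star>\<^bsub>M\<^esub> r"] c x r by simp
    then show ?thesis using coset_eq_iff[of "y \<star>\<^bsub>M\<^esub> r" "x \<star>\<^bsub>M\<^esub> r"] ar a c x r by simp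
  qed
  moreover have "x \<in> A +>\<^bsub>M\<^esub> x" using A'(2) x M.l_zero[of x] unfolding a_r_coset_def' by force
  ultimately have "(\<Union>y\<in>A +>\<^bsub>M\<^esub> x. A +>\<^bsub>M\<^esub> (y \<star>\<^bsub>M\<^esub> r)) = A +>\<^bsub>M\<^esub> (x \<star>\<^bsub>M\<^esub> r)" by blast
  then show "(A +>\<^bsub>M\<^esub> x) \<star>\<^bsub>quotient_rmodule M A\<^esub> r = A +>\<^bsub>M\<^esub> (x \<star>\<^bsub>M\<^esub> r)"
    by (simp add: quotient_rmodule_def)
qed

lemma quotient_right_module: "right_module R (quotient_rmodule M A)"
proof (rule right_moduleI)
  fix X assume "X \<in> carrier (quotient_rmodule M A)"
  then obtain x where x: "x \<in> carrier M" "X = A +>\<^bsub>M\<^esub> x" by (auto simp: quotient_simps(1))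
  have "(A +>\<^bsub>M\<^esub> (\<ominus>\<^bsub>M\<^esub> x)) \<oplus>\<^bsub>quotient_rmodule M A\<^esub> X = \<zero>\<^bsub>quotient_rmodule M A\<^esub>"
    using x by (simp add: quotient_simps M.l_neg)
  moreover have "A +>\<^bsub>M\<^esub> (\<ominus>\<^bsub>M\<^esub> x) \<in> carrier (quotient_rmodule M A)"
    using x by (simp add: quotient_simps)
  ultimately show "\<exists>Y\<in>carrier (quotient_rmodule M A).
      Y \<oplus>\<^bsub>quotient_rmodule M A\<^esub> X = \<zero>\<^bsub>quotient_rmodule M A\<^esub>" by blast
qed (auto simp: quotient_simps M.a_ac rsmult_add_left rsmult_add_right rsmult_assoc R.ring_axioms)

lemma quotient_hom: "(\<lambda>x. A +>\<^bsub>M\<^esub> x) \<in> rmodule_hom R M (quotient_rmodule M A)"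
  by (auto simp: rmodule_hom_def quotient_simps)

lemma coset_eq_zero_iff:
  assumes "x \<in> carrier M" shows "A +>\<^bsub>M\<^esub> x = \<zero>\<^bsub>quotient_rmodule M A\<^esub> \<longleftrightarrow> x \<in> A"
  using coset_eq_iff[OF assms M.zero_closed] add_eq_imp_eq_diff(1)[of x "\<zero>\<^bsub>M\<^esub>" x] assms
  by (simp add: quotient_simps(2))

end

end

section \<open>Splitting the socle of a cyclic submodule\<close>

text \<open>
  Any nonzero element of a simple submodule of \<open>M/socle\<close> lifts to such an \<open>x\<close>. The last condition
  says that \<open>xR + socle\<close> covers the socle in the lattice of submodules, in a form that only
  mentions submodules of \<open>xR\<close>.
\<close>

lemma exists_generator_over_socle:
  assumes sa: "right_semiartinian R" and M: "right_module R M" and ne: "socle R M \<noteq> carrier M"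
  obtains x where "x \<in> carrier M" "x \<notin> socle R M"
    "\<And>K. \<lbrakk>rsubmodule R M K; K \<subseteq> {x \<star>\<^bsub>M\<^esub> r | r. r \<in> carrier R}; \<not> K \<subseteq> socle R M\<rbrakk> \<Longrightarrow>
      {x \<star>\<^bsub>M\<^esub> r | r. r \<in> carrier R} \<subseteq> K <+>\<^bsub>M\<^esub> socle R M"
proof -
  interpret M: right_module R M by fact
  let ?S = "socle R M"
  let ?Q = "quotient_rmodule M ?S" and ?q = "\<lambda>x. ?S +>\<^bsub>M\<^esub> x"
  note S = M.rsubmodule_socle
  note mQ = M.quotient_right_module[OF S] and q = M.quotient_hom[OF S]
  note zero = M.coset_eq_zero_iff[OF S]
  interpret Q: right_module R ?Q by (rule mQ)
  obtain y where y: "y \<in> carrier M" "y \<notin> ?S" using ne rsubmoduleD(1)[OF S] by blast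
  then have "?q y \<noteq> \<zero>\<^bsub>?Q\<^esub>" "?q y \<in> carrier ?Q" using zero rmodule_homD(1)[OF q] by auto
  then have "carrier ?Q \<noteq> {\<zero>\<^bsub>?Q\<^esub>}" by blast
  then obtain V where V: "rsubmodule R ?Q V" "simple_rmodule R (?Q\<lparr>carrier := V\<rparr>)"
    using right_semiartinian_any_type[OF sa mQ] by blast
  then have V': "V \<noteq> {\<zero>\<^bsub>?Q\<^esub>}"
    "\<And>W. \<lbrakk>rsubmodule R ?Q W; W \<subseteq> V\<rbrakk> \<Longrightarrow> W = {\<zero>\<^bsub>?Q\<^esub>} \<or> W = V"
    unfolding Q.simple_restrict_iff[OF V(1)] by blast+
  obtain v where v: "v \<in> V" "v \<noteq> \<zero>\<^bsub>?Q\<^esub>" using V'(1) rsubmoduleD(2)[OF V(1)] by blast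
  then have "v \<in> carrier ?Q" using rsubmoduleD(1)[OF V(1)] by blast
  then obtain x where x: "x \<in> carrier M" "v = ?q x" by (auto simp: M.quotient_simps(1)[OF S])
  let ?J = "{x \<star>\<^bsub>M\<^esub> r | r. r \<in> carrier R}"
  have J: "?q z \<in> V" "z \<in> carrier M" if z: "z \<in> ?J" for z
  proof -
    obtain r where r: "r \<in> carrier R" "z = x \<star>\<^bsub>M\<^esub> r" using z by blast
    show "z \<in> carrier M" using r x by simp
    show "?q z \<in> V"
      using rsubmoduleD(4)[OF V(1) v(1) r(1)] rmodule_homD(3)[OF q x(1) r(1)] r(2) x(2) by simp
  qed
  have "?J \<subseteq> K <+>\<^bsub>M\<^esub> ?S" if K: "rsubmodule R M K" "K \<subseteq> ?J" "\<not> K \<subseteq> ?S" for K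
  proof
    fix z assume z: "z \<in> ?J"
    have "rsubmodule R ?Q (?q ` K)" by (rule rsubmodule_hom_image[OF M mQ q K(1)])
    moreover have "?q ` K \<subseteq> V" using K(2) J(1) by blast
    moreover have "?q ` K \<noteq> {\<zero>\<^bsub>?Q\<^esub>}"
    proof -
      obtain k where k: "k \<in> K" "k \<notin> ?S" using K(3) by blast
      then have "k \<in> carrier M" using rsubmoduleD(1)[OF K(1)] by blast
      then have "?q k \<noteq> \<zero>\<^bsub>?Q\<^esub>" using zero k(2) by simp
      then show ?thesis using k(1) by blast
    qed
    ultimately have "?q ` K = V" using V'(2) by blast
    then obtain k where k: "k \<in> K" "?q z = ?q k" using J(1)[OF z] by blast
    have c: "z \<in> carrier M" "k \<in> carrier M" using J(2)[OF z] k(1) rsubmoduleD(1)[OF K(1)] by auto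
    have "z \<ominus>\<^bsub>M\<^esub> k \<in> ?S" using M.coset_eq_iff[OF S c] k(2) by simp
    moreover have "z = k \<oplus>\<^bsub>M\<^esub> (z \<ominus>\<^bsub>M\<^esub> k)"
      by (rule M.eq_add_diff[OF c])
    ultimately show "z \<in> K <+>\<^bsub>M\<^esub> ?S" using k(1) unfolding mem_set_add_iff by blast
  qed
  moreover have "x \<notin> ?S" using v(2) zero[OF x(1)] x(2) by simp
  ultimately show thesis using that[of x] x(1) by blast
qed

context right_module begin

text \<open>
  The condition that \<open>D\<close> is not contained in the socle is inherited by the complement of \<open>T\<close>, so
  that the splitting can be repeated indefinitely.
\<close>

lemma split_off_simple:
  assumes sa: "right_semiartinian R" and v: "right_V_ring R"
    and D: "rsubmodule R M D" "\<not> D \<subseteq> socle R M"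
  obtains T D' where "rsubmodule R M T" "T \<noteq> {\<zero>\<^bsub>M\<^esub>}" "T \<subseteq> D" "T \<subseteq> socle R M"
    "rsubmodule R M D'" "D' \<subseteq> D" "T \<inter> D' = {\<zero>\<^bsub>M\<^esub>}" "\<not> D' \<subseteq> socle R M"
proof -
  note mD = rsubmodule_right_module[OF D(1)]
  have "D \<noteq> {\<zero>\<^bsub>M\<^esub>}" using D(2) rsubmoduleD(2)[OF rsubmodule_socle] by blast
  then obtain T where T: "rsubmodule R (M\<lparr>carrier := D\<rparr>) T"
    "simple_rmodule R (M\<lparr>carrier := D, carrier := T\<rparr>)"
    using right_semiartinian_any_type[OF sa mD] by auto
  then have T': "rsubmodule R M T" "T \<subseteq> D" "simple_rmodule R (M\<lparr>carrier := T\<rparr>)"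
    using rsubmodule_restrict[OF D(1) right_module_axioms] by auto
  have "T \<noteq> {\<zero>\<^bsub>M\<^esub>}" using T'(3) unfolding simple_restrict_iff[OF T'(1)] by blast
  have TS: "T \<subseteq> socle R M" by (rule simple_subset_socle[OF T'(1,3)])
  have "direct_summand R (M\<lparr>carrier := D\<rparr>) T"
    by (rule injective_direct_summand[OF D(1) T'(1,2) right_V_ring_any_type[OF v T'(3)]])
  then obtain D' where D': "rsubmodule R M D'" "D' \<subseteq> D" "D \<subseteq> T <+>\<^bsub>M\<^esub> D'" "T \<inter> D' = {\<zero>\<^bsub>M\<^esub>}"
    unfolding direct_summand_restrict_iff[OF D(1)] by blast
  have "\<not> D' \<subseteq> socle R M"
    using D(2) D'(3) set_add_least[OF rsubmodule_socle TS] by blast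
  then show thesis using that T'(1,2) \<open>T \<noteq> {\<zero>\<^bsub>M\<^esub>}\<close> TS D'(1,2,4) by blast
qed

text \<open>
  Moving a summand of the remainder \<open>D\<close> into \<open>E\<close> preserves the independence of \<open>E\<close>, \<open>F\<close> and
  the remainder, where independence of three submodules is encoded by two binary intersections.
\<close>

lemma enlarge_independent:
  assumes E: "rsubmodule R M E" and F: "rsubmodule R M F" and D: "rsubmodule R M D"
    and T: "rsubmodule R M T" "T \<subseteq> D" and D': "rsubmodule R M D'" "D' \<subseteq> D"
    and EO: "E \<inter> F = {\<zero>\<^bsub>M\<^esub>}" and EOD: "(E <+>\<^bsub>M\<^esub> F) \<inter> D = {\<zero>\<^bsub>M\<^esub>}"
    and TD': "T \<inter> D' = {\<zero>\<^bsub>M\<^esub>}"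
  shows "(E <+>\<^bsub>M\<^esub> T) \<inter> F = {\<zero>\<^bsub>M\<^esub>}" "((E <+>\<^bsub>M\<^esub> T) <+>\<^bsub>M\<^esub> F) \<inter> D' = {\<zero>\<^bsub>M\<^esub>}"
proof -
  note sEO = rsubmodule_set_add[OF E F] and sET = rsubmodule_set_add[OF E T(1)]
  note sETO = rsubmodule_set_add[OF sET F]
  have "z = \<zero>\<^bsub>M\<^esub>" if z: "z \<in> E <+>\<^bsub>M\<^esub> T" "z \<in> F" for z
  proof -
    obtain e t where et: "e \<in> E" "t \<in> T" "z = e \<oplus>\<^bsub>M\<^esub> t" using z unfolding mem_set_add_iff by blast
    have c: "e \<in> carrier M" "t \<in> carrier M"
      using et rsubmoduleD(1)[OF E] rsubmoduleD(1)[OF T(1)] by auto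
    have "e \<in> E <+>\<^bsub>M\<^esub> F" "z \<in> E <+>\<^bsub>M\<^esub> F" using et z set_add_upper[OF E F] by auto
    then have "t \<in> E <+>\<^bsub>M\<^esub> F" using rsubmodule_cancel[OF sEO c] et(3) by simp
    then have "t = \<zero>\<^bsub>M\<^esub>" using EOD et(2) T(2) by blast
    then show ?thesis using et c z EO by auto
  qed
  then show "(E <+>\<^bsub>M\<^esub> T) \<inter> F = {\<zero>\<^bsub>M\<^esub>}"
    using rsubmoduleD(2)[OF sET] rsubmoduleD(2)[OF F] by blast
  have "z = \<zero>\<^bsub>M\<^esub>" if z: "z \<in> (E <+>\<^bsub>M\<^esub> T) <+>\<^bsub>M\<^esub> F" "z \<in> D'" for z
  proof -
    obtain y f where "y \<in> E <+>\<^bsub>M\<^esub> T" "f \<in> F" "z = y \<oplus>\<^bsub>M\<^esub> f"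
      using z(1) mem_set_add_iff[of z] by blast
    then obtain e t where eto: "e \<in> E" "t \<in> T" "f \<in> F" "z = (e \<oplus>\<^bsub>M\<^esub> t) \<oplus>\<^bsub>M\<^esub> f"
      unfolding mem_set_add_iff by blast
    have c: "e \<in> carrier M" "t \<in> carrier M" "f \<in> carrier M"
      using eto rsubmoduleD(1)[OF E] rsubmoduleD(1)[OF T(1)] rsubmoduleD(1)[OF F] by auto
    have z': "z = t \<oplus>\<^bsub>M\<^esub> (e \<oplus>\<^bsub>M\<^esub> f)" using eto(4) c by (simp add: M.a_ac)
    have "z \<in> D" "t \<in> D" using z(2) D'(2) eto(2) T(2) by auto
    then have "e \<oplus>\<^bsub>M\<^esub> f \<in> D" using rsubmodule_cancel[OF D, of t "e \<oplus>\<^bsub>M\<^esub> f"] z' c by simp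
    moreover have "e \<oplus>\<^bsub>M\<^esub> f \<in> E <+>\<^bsub>M\<^esub> F" using eto unfolding mem_set_add_iff by blast
    ultimately have "e \<oplus>\<^bsub>M\<^esub> f = \<zero>\<^bsub>M\<^esub>" using EOD by blast
    then have "z = t" using z' c by simp
    then show ?thesis using eto(2) z(2) TD' by blast
  qed
  then show "((E <+>\<^bsub>M\<^esub> T) <+>\<^bsub>M\<^esub> F) \<inter> D' = {\<zero>\<^bsub>M\<^esub>}"
    using rsubmoduleD(2)[OF sETO] rsubmoduleD(2)[OF D'(1)] by blast
qed

lemma set_add_commute:
  assumes "rsubmodule R M A" "rsubmodule R M B"
  shows "A <+>\<^bsub>M\<^esub> B = B <+>\<^bsub>M\<^esub> A"
proof -
  have "A <+>\<^bsub>M\<^esub> B \<subseteq> B <+>\<^bsub>M\<^esub> A" if "rsubmodule R M A" "rsubmodule R M B" for A B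
    by (rule set_add_least[OF rsubmodule_set_add set_add_upper(2,1)]) (rule that)+
  then show ?thesis using assms by blast
qed

lemma psubset_set_add:
  assumes "rsubmodule R M A" "rsubmodule R M T" "T \<noteq> {\<zero>\<^bsub>M\<^esub>}" "A \<inter> T \<subseteq> {\<zero>\<^bsub>M\<^esub>}"
  shows "A \<subset> A <+>\<^bsub>M\<^esub> T"
  using set_add_upper[OF assms(1,2)] rsubmoduleD(2)[OF assms(2)] assms(3,4) by blast

text \<open>
  Starting from \<open>E = F = 0\<close> and remainder \<open>J\<close>, simple submodules are moved from the remainder
  alternately to \<open>E\<close> and to \<open>F\<close>.
\<close>

lemma two_independent_chains:
  assumes sa: "right_semiartinian R" and v: "right_V_ring R"
    and J: "rsubmodule R M J" "\<not> J \<subseteq> socle R M"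
  obtains E F :: "nat \<Rightarrow> 'b set" where
    "\<And>n. rsubmodule R M (E n)" "\<And>n. E n \<subset> E (Suc n)" "\<And>n. E n \<subseteq> J \<inter> socle R M"
    "\<And>n. rsubmodule R M (F n)" "\<And>n. F n \<subset> F (Suc n)" "\<And>n. F n \<subseteq> J \<inter> socle R M"
    "\<And>n. E n \<inter> F n = {\<zero>\<^bsub>M\<^esub>}"
proof -
  let ?I = "J \<inter> socle R M"
  \<comment> \<open>\<open>D\<close> is the remainder, from which the next simple submodules are split off\<close>
  define good where "good = (\<lambda>(E, F, D). rsubmodule R M E \<and> rsubmodule R M F \<and> rsubmodule R M D \<and>
    E \<subseteq> ?I \<and> F \<subseteq> ?I \<and> D \<subseteq> J \<and> E \<inter> F = {\<zero>\<^bsub>M\<^esub>} \<and> (E <+>\<^bsub>M\<^esub> F) \<inter> D = {\<zero>\<^bsub>M\<^esub>} \<and>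
    \<not> D \<subseteq> socle R M)"
  have I: "rsubmodule R M ?I" by (rule rsubmodule_Int[OF J(1) rsubmodule_socle])
  have step: "\<exists>E' D'. good (E', F, D') \<and> E \<subset> E'" if g: "good (E, F, D)" for E F D
  proof -
    have G: "rsubmodule R M E" "rsubmodule R M F" "rsubmodule R M D" "E \<subseteq> ?I" "F \<subseteq> ?I" "D \<subseteq> J"
      "E \<inter> F = {\<zero>\<^bsub>M\<^esub>}" "(E <+>\<^bsub>M\<^esub> F) \<inter> D = {\<zero>\<^bsub>M\<^esub>}" "\<not> D \<subseteq> socle R M"
      using g unfolding good_def by auto
    obtain T D' where T: "rsubmodule R M T" "T \<noteq> {\<zero>\<^bsub>M\<^esub>}" "T \<subseteq> D" "T \<subseteq> socle R M"
      and D': "rsubmodule R M D'" "D' \<subseteq> D" "T \<inter> D' = {\<zero>\<^bsub>M\<^esub>}" "\<not> D' \<subseteq> socle R M"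
      by (rule split_off_simple[OF sa v G(3,9)])
    note ind = enlarge_independent[OF G(1,2,3) T(1,3) D'(1,2) G(7,8) D'(3)]
    have "E <+>\<^bsub>M\<^esub> T \<subseteq> ?I" by (rule set_add_least[OF I G(4)]) (use T(3,4) G(6) in blast)
    then have "good (E <+>\<^bsub>M\<^esub> T, F, D')"
      using rsubmodule_set_add[OF G(1) T(1)] G D' ind unfolding good_def by auto
    moreover have "E \<subset> E <+>\<^bsub>M\<^esub> T"
      by (rule psubset_set_add[OF G(1) T(1,2)]) (use set_add_upper[OF G(1,2)] T(3) G(8) in blast)
    ultimately show ?thesis by blast
  qed
  have swap: "good (F, E, D)" if "good (E, F, D)" for E F D
    using that set_add_commute[of E F] unfolding good_def by (auto simp: Int_commute)
  \<comment> \<open>one step for each of the two chains, the second one with their roles exchanged\<close>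
  have step2: "\<exists>Y. good Y \<and> fst X \<subset> fst Y \<and> fst (snd X) \<subset> fst (snd Y)" if g: "good X" for X
  proof -
    obtain E F D where X: "X = (E, F, D)" by (cases X)
    with g have g': "good (E, F, D)" by simp
    obtain E' D' where 1: "good (E', F, D')" "E \<subset> E'" using step[OF g'] by blast
    obtain F' D'' where 2: "good (F', E', D'')" "F \<subset> F'" using step[OF swap[OF 1(1)]] by blast
    show ?thesis
      by (rule exI[of _ "(E', F', D'')"]) (use swap[OF 2(1)] 1(2) 2(2) X in simp)
  qed
  have "{\<zero>\<^bsub>M\<^esub>} <+>\<^bsub>M\<^esub> {\<zero>\<^bsub>M\<^esub>} = {\<zero>\<^bsub>M\<^esub>}" by (simp add: set_add_def')
  then have "good ({\<zero>\<^bsub>M\<^esub>}, {\<zero>\<^bsub>M\<^esub>}, J)"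
    using J rsubmodule_zero rsubmoduleD(2)[OF I] unfolding good_def by auto
  then obtain X where X: "\<And>n. good (X n)"
    "\<And>n. fst (X n) \<subset> fst (X (Suc n)) \<and> fst (snd (X n)) \<subset> fst (snd (X (Suc n)))"
    using dependent_nat_choice[of "\<lambda>_. good"
        "\<lambda>_ X Y. fst X \<subset> fst Y \<and> fst (snd X) \<subset> fst (snd Y)"] step2 by metis
  show thesis
    by (rule that[of "\<lambda>n. fst (X n)" "\<lambda>n. fst (snd (X n))"])
      (use X in \<open>auto simp: good_def split_beta\<close>)
qed

text \<open>
  The submodule \<open>B\<close> is the union of one of the two chains, while the union \<open>A0\<close> of the other one is
  enlarged to a complement \<open>A\<close> of \<open>B\<close> in \<open>J \<inter> socle\<close>. The chains make \<open>A0\<close> and \<open>B\<close>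
  nonsummands, and this passes from \<open>A0\<close> to \<open>A\<close> because \<open>A0\<close> is a summand of \<open>A\<close>.
\<close>

lemma socle_part_is_sum_of_nonsummands:
  assumes sa: "right_semiartinian R" and v: "right_V_ring R"
    and x: "x \<in> carrier M" "x \<notin> socle R M" and J: "J = {x \<star>\<^bsub>M\<^esub> r | r. r \<in> carrier R}"
  obtains A B where "rsubmodule R M A" "rsubmodule R M B" "A \<subseteq> J \<inter> socle R M" "B \<subseteq> J \<inter> socle R M"
    "A \<inter> B = {\<zero>\<^bsub>M\<^esub>}" "J \<inter> socle R M \<subseteq> A <+>\<^bsub>M\<^esub> B"
    "\<not> direct_summand R (M\<lparr>carrier := J\<rparr>) A" "\<not> direct_summand R (M\<lparr>carrier := J\<rparr>) B"
proof -
  let ?I = "J \<inter> socle R M"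
  have subJ: "rsubmodule R M J" unfolding J by (rule cyclic_rsubmodule[OF x(1)])
  have I: "rsubmodule R M ?I" by (rule rsubmodule_Int[OF subJ rsubmodule_socle])
  have "x \<in> J" unfolding J using rsmult_one[OF x(1)] R.one_closed by force
  then have "\<not> J \<subseteq> socle R M" using x(2) by blast
  then obtain E F :: "nat \<Rightarrow> 'b set" where
    E: "\<And>n. rsubmodule R M (E n)" "\<And>n. E n \<subset> E (Suc n)" "\<And>n. E n \<subseteq> ?I" and
    F: "\<And>n. rsubmodule R M (F n)" "\<And>n. F n \<subset> F (Suc n)" "\<And>n. F n \<subseteq> ?I" and
    EO: "\<And>n. E n \<inter> F n = {\<zero>\<^bsub>M\<^esub>}"
    using two_independent_chains[OF sa v subJ] by metis
  have mono: "E m \<subseteq> E n" "F m \<subseteq> F n" if "m \<le> n" for m n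
    using lift_Suc_mono_le[of E, OF psubset_imp_subset[OF E(2)] that]
      lift_Suc_mono_le[of F, OF psubset_imp_subset[OF F(2)] that] by simp_all
  define A0 where "A0 = (\<Union>n. E n)"
  define B where "B = (\<Union>n. F n)"
  have Union: "rsubmodule R M (\<Union>n. N n)"
    if "\<And>n. rsubmodule R M (N n)" "\<And>m n. m \<le> n \<Longrightarrow> N m \<subseteq> N n" for N :: "nat \<Rightarrow> 'b set"
  proof (rule rsubmodule_chain_Union)
    fix X Y assume "X \<in> range N" "Y \<in> range N"
    then obtain m n where "X = N m" "Y = N n" by blast
    then show "X \<subseteq> Y \<or> Y \<subseteq> X" using that(2)[of m n] that(2)[of n m] nat_le_linear[of m n] by blast
  qed (use that(1) in auto)
  have A0: "rsubmodule R M A0" "A0 \<subseteq> ?I" and B: "rsubmodule R M B" "B \<subseteq> ?I"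
    unfolding A0_def B_def using Union[of E, OF E(1) mono(1)] Union[of F, OF F(1) mono(2)] E(3) F(3) by blast+
  have "z = \<zero>\<^bsub>M\<^esub>" if "z \<in> B" "z \<in> A0" for z
  proof -
    obtain m n where "z \<in> F m" "z \<in> E n" using \<open>z \<in> B\<close> \<open>z \<in> A0\<close> unfolding A0_def B_def by blast
    then have "z \<in> E (max m n) \<inter> F (max m n)" using mono by (meson IntI max.cobounded1 max.cobounded2 subsetD)
    then show ?thesis using EO by blast
  qed
  then have BA0: "B \<inter> A0 = {\<zero>\<^bsub>M\<^esub>}" using rsubmoduleD(2)[OF A0(1)] rsubmoduleD(2)[OF B(1)] by blast
  obtain C where C: "rsubmodule R M C" "A0 \<subseteq> C" "B \<inter> C = {\<zero>\<^bsub>M\<^esub>}" "socle R M \<subseteq> B <+>\<^bsub>M\<^esub> C"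
    by (rule complement_in_socle[OF B(1) A0(1) BA0])
  define A where "A = C \<inter> ?I"
  have A: "rsubmodule R M A" "A \<subseteq> ?I" "A0 \<subseteq> A"
    using rsubmodule_Int[OF C(1) I] A0(2) C(2) unfolding A_def by auto
  have AB: "A \<inter> B = {\<zero>\<^bsub>M\<^esub>}"
    using C(3) rsubmoduleD(2)[OF A(1)] rsubmoduleD(2)[OF B(1)] unfolding A_def by blast
  have IAB: "?I \<subseteq> A <+>\<^bsub>M\<^esub> B"
  proof
    fix z assume z: "z \<in> ?I"
    then obtain b c where bc: "b \<in> B" "c \<in> C" "z = b \<oplus>\<^bsub>M\<^esub> c"
      using C(4) mem_set_add_iff[of z M B C] by blast
    have car: "b \<in> carrier M" "c \<in> carrier M"
      using bc rsubmoduleD(1)[OF B(1)] rsubmoduleD(1)[OF C(1)] by auto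
    have "c \<in> ?I" using rsubmodule_cancel[OF I car] bc z B(2) by blast
    then show "z \<in> A <+>\<^bsub>M\<^esub> B"
      using bc M.a_comm[OF car] unfolding mem_set_add_iff A_def by blast
  qed
  have nB: "\<not> direct_summand R (M\<lparr>carrier := J\<rparr>) B"
    unfolding B_def by (rule chain_Union_not_direct_summand[of _ _ F, OF x(1) J F(1,2)])
  have nA0: "\<not> direct_summand R (M\<lparr>carrier := J\<rparr>) A0"
    unfolding A0_def by (rule chain_Union_not_direct_summand[of _ _ E, OF x(1) J E(1,2)])
  have nA: "\<not> direct_summand R (M\<lparr>carrier := J\<rparr>) A"
  proof
    assume "direct_summand R (M\<lparr>carrier := J\<rparr>) A"
    then obtain K where K: "rsubmodule R M K" "K \<subseteq> J" "J \<subseteq> A <+>\<^bsub>M\<^esub> K" "A \<inter> K = {\<zero>\<^bsub>M\<^esub>}"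
      unfolding direct_summand_restrict_iff[OF subJ] by blast
    have "A0 \<inter> {\<zero>\<^bsub>M\<^esub>} = {\<zero>\<^bsub>M\<^esub>}" using rsubmoduleD(2)[OF A0(1)] by blast
    then obtain D where D: "rsubmodule R M D" "A0 \<inter> D = {\<zero>\<^bsub>M\<^esub>}" "socle R M \<subseteq> A0 <+>\<^bsub>M\<^esub> D"
      by (rule complement_in_socle[OF A0(1) rsubmodule_zero])
    \<comment> \<open>\<open>A = A0 \<oplus> (D \<inter> A)\<close> by modularity, hence \<open>L\<close> is a complement of \<open>A0\<close> in \<open>J\<close>\<close>
    define L where "L = (D \<inter> A) <+>\<^bsub>M\<^esub> K"
    have DA: "rsubmodule R M (D \<inter> A)" by (rule rsubmodule_Int[OF D(1) A(1)])
    have L: "rsubmodule R M L" unfolding L_def by (rule rsubmodule_set_add[OF DA K(1)])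
    have LJ: "L \<subseteq> J" unfolding L_def by (rule set_add_least[OF subJ]) (use A(2) K(2) in blast)+
    have "J \<subseteq> A0 <+>\<^bsub>M\<^esub> L"
    proof
      fix z assume "z \<in> J"
      then obtain a k where ak: "a \<in> A" "k \<in> K" "z = a \<oplus>\<^bsub>M\<^esub> k"
        using K(3) mem_set_add_iff[of z M A K] by blast
      obtain a0 d where ad: "a0 \<in> A0" "d \<in> D" "a = a0 \<oplus>\<^bsub>M\<^esub> d"
        using ak(1) A(2) D(3) mem_set_add_iff[of a M A0 D] by blast
      have c: "a0 \<in> carrier M" "d \<in> carrier M" "k \<in> carrier M"
        using ak ad rsubmoduleD(1)[OF A0(1)] rsubmoduleD(1)[OF D(1)] rsubmoduleD(1)[OF K(1)] by auto
      have "d \<in> A" using rsubmodule_cancel[OF A(1) c(1,2)] ad ak(1) A(3) by blast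
      then have "d \<oplus>\<^bsub>M\<^esub> k \<in> L" using ad(2) ak(2) unfolding mem_set_add_iff L_def by blast
      moreover have "z = a0 \<oplus>\<^bsub>M\<^esub> (d \<oplus>\<^bsub>M\<^esub> k)" using ak(3) ad(3) c by (simp add: M.a_assoc)
      ultimately show "z \<in> A0 <+>\<^bsub>M\<^esub> L" using ad(1) unfolding mem_set_add_iff by blast
    qed
    moreover have "z = \<zero>\<^bsub>M\<^esub>" if z: "z \<in> A0" "z \<in> L" for z
    proof -
      obtain d k where dk: "d \<in> D" "d \<in> A" "k \<in> K" "z = d \<oplus>\<^bsub>M\<^esub> k"
        using z(2) unfolding L_def mem_set_add_iff by blast
      have c: "d \<in> carrier M" "k \<in> carrier M"
        using dk rsubmoduleD(1)[OF D(1)] rsubmoduleD(1)[OF K(1)] by auto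
      have "k \<in> A" using rsubmodule_cancel[OF A(1) c] dk(2,4) z(1) A(3) by blast
      then have "k = \<zero>\<^bsub>M\<^esub>" using dk(3) K(4) by blast
      then show ?thesis using dk(1,4) c z(1) D(2) by auto
    qed
    ultimately have "direct_summand R (M\<lparr>carrier := J\<rparr>) A0"
      unfolding direct_summand_restrict_iff[OF subJ]
      using A0 L LJ rsubmoduleD(2)[OF A0(1)] rsubmoduleD(2)[OF L] by blast
    then show False using nA0 by contradiction
  qed
  show thesis by (rule that[OF A(1) B(1) A(2) B(2) AB IAB nA nB])
qed

section \<open>A cyclic module all of whose simple submodules are projective\<close>

text \<open>
  The simple submodule \<open>V\<close> is \<open>K/A\<close> for its preimage \<open>K\<close>, and the quotient map restricts to an
  isomorphism of \<open>T = B \<inter> K\<close> onto \<open>V\<close> as soon as \<open>T \<noteq> 0\<close>. If \<open>T = 0\<close>, then \<open>K\<close> meets \<open>A + B\<close>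
  only in \<open>A\<close>, so \<open>K\<close> is not contained in the socle, and \<open>over_socle\<close> makes \<open>K\<close> a complement of
  \<open>B\<close> in \<open>J\<close>.
\<close>

lemma simple_submodule_of_quotient:
  fixes A B J :: "'b set"
  defines "Q \<equiv> quotient_rmodule (M\<lparr>carrier := J\<rparr>) A"
  assumes J: "rsubmodule R M J"
    and over_socle: "\<And>K. \<lbrakk>rsubmodule R M K; K \<subseteq> J; \<not> K \<subseteq> socle R M\<rbrakk> \<Longrightarrow> J \<subseteq> K <+>\<^bsub>M\<^esub> socle R M"
    and A: "rsubmodule R M A" "A \<subseteq> J \<inter> socle R M" and B: "rsubmodule R M B" "B \<subseteq> J \<inter> socle R M"
    and AB: "A \<inter> B = {\<zero>\<^bsub>M\<^esub>}" "J \<inter> socle R M \<subseteq> A <+>\<^bsub>M\<^esub> B"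
    and nB: "\<not> direct_summand R (M\<lparr>carrier := J\<rparr>) B"
    and V: "rsubmodule R Q V" "simple_rmodule R (Q\<lparr>carrier := V\<rparr>)"
  obtains T f where "rsubmodule R M T"
    "f \<in> rmodule_hom R (M\<lparr>carrier := T\<rparr>) (Q\<lparr>carrier := V\<rparr>)" "bij_betw f T V"
proof -
  interpret J: right_module R "M\<lparr>carrier := J\<rparr>" by (rule rsubmodule_right_module[OF J])
  note restrict = rsubmodule_restrict[OF J right_module_axioms]
  have A': "rsubmodule R (M\<lparr>carrier := J\<rparr>) A" using restrict A by blast
  interpret Q: right_module R Q unfolding Q_def by (rule J.quotient_right_module[OF A'])
  define q where "q x = A +>\<^bsub>M\<lparr>carrier := J\<rparr>\<^esub> x" for x
  have q: "q \<in> rmodule_hom R (M\<lparr>carrier := J\<rparr>) Q"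
    using J.quotient_hom[OF A'] by (simp add: q_def[abs_def] Q_def)
  have zero: "q z = \<zero>\<^bsub>Q\<^esub> \<longleftrightarrow> z \<in> A" if "z \<in> J" for z
    using J.coset_eq_zero_iff[OF A', of z] that by (simp add: q_def Q_def)
  note qD = rmodule_homD[OF q, simplified]
  have V': "V \<noteq> {\<zero>\<^bsub>Q\<^esub>}" "\<And>W. \<lbrakk>rsubmodule R Q W; W \<subseteq> V\<rbrakk> \<Longrightarrow> W = {\<zero>\<^bsub>Q\<^esub>} \<or> W = V"
    using V(2) unfolding Q.simple_restrict_iff[OF V(1)] by blast+
  define K where "K = {z \<in> J. q z \<in> V}"
  have "rsubmodule R (M\<lparr>carrier := J\<rparr>) K"
    using rsubmodule_hom_vimage[OF J.right_module_axioms Q.right_module_axioms q V(1)]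
    by (simp add: K_def)
  then have K: "rsubmodule R M K" "K \<subseteq> J" using restrict by blast+
  have AK: "A \<subseteq> K"
  proof
    fix z assume z: "z \<in> A"
    then have "z \<in> J" using A(2) by blast
    moreover from this have "q z = \<zero>\<^bsub>Q\<^esub>" using z zero by simp
    ultimately show "z \<in> K" using rsubmoduleD(2)[OF V(1)] unfolding K_def by simp
  qed
  have "B \<inter> K \<noteq> {\<zero>\<^bsub>M\<^esub>}"
  proof
    assume BK: "B \<inter> K = {\<zero>\<^bsub>M\<^esub>}"
    have "\<not> K \<subseteq> socle R M"
    proof
      assume KS: "K \<subseteq> socle R M"
      have "z \<in> A" if z: "z \<in> K" for z
      proof -
        obtain a b where ab: "a \<in> A" "b \<in> B" "z = a \<oplus>\<^bsub>M\<^esub> b"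
          using z KS K(2) AB(2) mem_set_add_iff[of z M A B] by blast
        have c: "a \<in> carrier M" "b \<in> carrier M"
          using ab rsubmoduleD(1)[OF A(1)] rsubmoduleD(1)[OF B(1)] by auto
        have "b \<in> K" using rsubmodule_cancel[OF K(1) c] ab z AK by blast
        then have "b = \<zero>\<^bsub>M\<^esub>" using BK ab(2) by blast
        then show ?thesis using ab c by simp
      qed
      moreover obtain v where v: "v \<in> V" "v \<noteq> \<zero>\<^bsub>Q\<^esub>" using V'(1) rsubmoduleD(2)[OF V(1)] by blast
      moreover have "v \<in> q ` J"
        using v(1) rsubmoduleD(1)[OF V(1)] J.quotient_simps(1)[OF A'] by (auto simp: q_def Q_def)
      ultimately show False using zero unfolding K_def by blast
    qed
    from over_socle[OF K this] have JKS: "J \<subseteq> K <+>\<^bsub>M\<^esub> socle R M" .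
    have "J \<subseteq> B <+>\<^bsub>M\<^esub> K"
    proof
      fix z assume z: "z \<in> J"
      then obtain k u where ku: "k \<in> K" "u \<in> socle R M" "z = k \<oplus>\<^bsub>M\<^esub> u"
        using JKS mem_set_add_iff[of z M K "socle R M"] by blast
      have c: "k \<in> carrier M" "u \<in> carrier M"
        using ku rsubmoduleD(1)[OF K(1)] rsubmoduleD(1)[OF rsubmodule_socle] by auto
      have "u \<in> J" using rsubmodule_cancel[OF J c] ku z K(2) by blast
      then obtain a b where ab: "a \<in> A" "b \<in> B" "u = a \<oplus>\<^bsub>M\<^esub> b"
        using ku(2) AB(2) mem_set_add_iff[of u M A B] by blast
      have c': "a \<in> carrier M" "b \<in> carrier M"
        using ab rsubmoduleD(1)[OF A(1)] rsubmoduleD(1)[OF B(1)] by auto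
      have "z = b \<oplus>\<^bsub>M\<^esub> (k \<oplus>\<^bsub>M\<^esub> a)" using ku(3) ab(3) c(1) c' by (simp add: M.a_ac)
      moreover have "k \<oplus>\<^bsub>M\<^esub> a \<in> K" using rsubmoduleD(3)[OF K(1) ku(1)] ab(1) AK by blast
      ultimately show "z \<in> B <+>\<^bsub>M\<^esub> K" using ab(2) unfolding mem_set_add_iff by blast
    qed
    then have "direct_summand R (M\<lparr>carrier := J\<rparr>) B"
      unfolding direct_summand_restrict_iff[OF J] using B K BK by blast
    then show False using nB by contradiction
  qed
  define T where "T = B \<inter> K"
  have T: "rsubmodule R M T" "T \<subseteq> J"
    using rsubmodule_Int[OF B(1) K(1)] K(2) unfolding T_def by auto
  then have "rsubmodule R (M\<lparr>carrier := J\<rparr>) T" using restrict by blast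
  then have "rsubmodule R Q (q ` T)"
    by (rule rsubmodule_hom_image[OF J.right_module_axioms Q.right_module_axioms q])
  moreover have TV: "q ` T \<subseteq> V" unfolding T_def K_def by blast
  moreover have "q ` T \<noteq> {\<zero>\<^bsub>Q\<^esub>}"
  proof -
    obtain t where t: "t \<in> T" "t \<noteq> \<zero>\<^bsub>M\<^esub>"
      using \<open>B \<inter> K \<noteq> {\<zero>\<^bsub>M\<^esub>}\<close> rsubmoduleD(2)[OF T(1)] unfolding T_def by blast
    then have "t \<notin> A" using AB(1) unfolding T_def by blast
    then have "q t \<noteq> \<zero>\<^bsub>Q\<^esub>" using zero t(1) T(2) by blast
    then show ?thesis using t(1) by blast
  qed
  ultimately have im: "q ` T = V" using V'(2) by blast
  have "inj_on q T"
  proof (rule inj_onI)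
    fix y z assume yz: "y \<in> T" "z \<in> T" "q y = q z"
    then have c: "y \<in> J" "z \<in> J" using T(2) by auto
    then have cM: "y \<in> carrier M" "z \<in> carrier M" using rsubmoduleD(1)[OF J] by auto
    have "q (y \<ominus>\<^bsub>M\<lparr>carrier := J\<rparr>\<^esub> z) = \<zero>\<^bsub>Q\<^esub>"
      using hom_eq_iff_diff[OF J.right_module_axioms Q.right_module_axioms q, of y z] c yz(3) by simp
    moreover have "y \<ominus>\<^bsub>M\<lparr>carrier := J\<rparr>\<^esub> z = y \<ominus>\<^bsub>M\<^esub> z"
      using J.rsmult_minus_one[of z] rsmult_minus_one[of z] c cM by (simp add: M.minus_eq J.M.minus_eq)
    moreover have d: "y \<ominus>\<^bsub>M\<^esub> z \<in> T" using rsubmodule_diff[OF T(1)] yz by blast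
    ultimately have "y \<ominus>\<^bsub>M\<^esub> z \<in> A" using zero T(2) by auto
    then have "y \<ominus>\<^bsub>M\<^esub> z = \<zero>\<^bsub>M\<^esub>" using d AB(1) unfolding T_def by blast
    then show "y = z" using diff_eq_zero_iff[OF cM] by simp
  qed
  moreover have "q \<in> rmodule_hom R (M\<lparr>carrier := T\<rparr>) (Q\<lparr>carrier := V\<rparr>)"
    using TV T(2) qD(2,3) by (auto simp: rmodule_hom_def subset_iff)
  ultimately show thesis using that T(1) im by (auto simp: bij_betw_def)
qed

end

theorem theorem4p6:
  fixes R :: "('a, 'r) ring_scheme"
  assumes "ring R"
    and "right_semiartinian R"
    and "right_V_ring R"
    and "\<not> semisimple_ring R"
  shows "\<exists>M :: ('a, 'a set) rmodule. cyclic_rmodule R M \<and>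
    \<not> (\<exists>P N. internal_direct_sum R M P N \<and>
          projective_rmodule R (M\<lparr>carrier := P\<rparr>) \<and>
          stable_rmodule R (M\<lparr>carrier := N\<rparr>))"
proof -
  let ?M = "regular_rmodule R"
  interpret M: right_module R ?M by (rule regular_right_module[OF assms(1)])
  have "socle R ?M \<noteq> carrier ?M"
    using M.semisimple_if_socle_eq_carrier assms(1,4) unfolding semisimple_ring_def by blast
  then obtain x where x: "x \<in> carrier ?M" "x \<notin> socle R ?M"
    and over_socle: "\<And>K. \<lbrakk>rsubmodule R ?M K; K \<subseteq> {x \<star>\<^bsub>?M\<^esub> r | r. r \<in> carrier R};
        \<not> K \<subseteq> socle R ?M\<rbrakk> \<Longrightarrow>
      {x \<star>\<^bsub>?M\<^esub> r | r. r \<in> carrier R} \<subseteq> K <+>\<^bsub>?M\<^esub> socle R ?M"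
    using exists_generator_over_socle[OF assms(2) M.right_module_axioms] by blast
  define J where "J = {x \<star>\<^bsub>?M\<^esub> r | r. r \<in> carrier R}"
  note over_socle = over_socle[folded J_def]
  have J: "rsubmodule R ?M J" unfolding J_def by (rule M.cyclic_rsubmodule[OF x(1)])
  have xJ: "x \<in> J" unfolding J_def using M.rsmult_one[OF x(1)] M.R.one_closed by force
  obtain A B where A: "rsubmodule R ?M A" "A \<subseteq> J \<inter> socle R ?M"
    and B: "rsubmodule R ?M B" "B \<subseteq> J \<inter> socle R ?M"
    and AB: "A \<inter> B = {\<zero>\<^bsub>?M\<^esub>}" "J \<inter> socle R ?M \<subseteq> A <+>\<^bsub>?M\<^esub> B"
    and nA: "\<not> direct_summand R (?M\<lparr>carrier := J\<rparr>) A"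
    and nB: "\<not> direct_summand R (?M\<lparr>carrier := J\<rparr>) B"
    by (rule M.socle_part_is_sum_of_nonsummands[OF assms(2,3) x J_def]) (rule that)
  interpret J: right_module R "?M\<lparr>carrier := J\<rparr>" by (rule M.rsubmodule_right_module[OF J])
  have A': "rsubmodule R (?M\<lparr>carrier := J\<rparr>) A"
    using rsubmodule_restrict[OF J M.right_module_axioms] A by blast
  define Q where "Q = quotient_rmodule (?M\<lparr>carrier := J\<rparr>) A"
  define q where "q y = A +>\<^bsub>?M\<lparr>carrier := J\<rparr>\<^esub> y" for y
  interpret Q: right_module R Q unfolding Q_def by (rule J.quotient_right_module[OF A'])
  have q: "q \<in> rmodule_hom R (?M\<lparr>carrier := J\<rparr>) Q"
    using J.quotient_hom[OF A'] by (simp add: q_def[abs_def] Q_def)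
  have qJ: "q ` J = carrier Q"
    using J.quotient_simps(1)[OF A'] by (simp add: q_def[abs_def] Q_def)
  have ker: "{y \<in> J. q y = \<zero>\<^bsub>Q\<^esub>} = A"
    using J.coset_eq_zero_iff[OF A'] A(2) by (auto simp: q_def Q_def)
  have "cyclic_rmodule R Q"
    unfolding cyclic_rmodule_def
  proof (intro conjI bexI)
    have "q (x \<star>\<^bsub>?M\<^esub> r) = q x \<star>\<^bsub>Q\<^esub> r" if "r \<in> carrier R" for r
      using rmodule_homD(3)[OF q, of x r] xJ that by simp
    then show "carrier Q = {q x \<star>\<^bsub>Q\<^esub> r | r. r \<in> carrier R}"
      unfolding qJ[symmetric] J_def by (auto simp: image_iff)
    show "q x \<in> carrier Q" using qJ xJ by blast
  qed (rule Q.right_module_axioms)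
  moreover have False
    if PN: "internal_direct_sum R Q P N" and P: "projective_rmodule R (Q\<lparr>carrier := P\<rparr>)"
      and N: "stable_rmodule R (Q\<lparr>carrier := N\<rparr>)" for P N
  proof -
    have sub: "rsubmodule R Q P" "rsubmodule R Q N" "P <+>\<^bsub>Q\<^esub> N = carrier Q"
      using PN unfolding internal_direct_sum_def by blast+
    \<comment> \<open>a simple submodule of \<open>N\<close> would be a nonzero projective summand of \<open>N\<close>\<close>
    have "N = {\<zero>\<^bsub>Q\<^esub>}"
    proof (rule ccontr)
      assume "N \<noteq> {\<zero>\<^bsub>Q\<^esub>}"
      then obtain V where "rsubmodule R (Q\<lparr>carrier := N\<rparr>) V" "simple_rmodule R (Q\<lparr>carrier := V\<rparr>)"
        using right_semiartinian_any_type[OF assms(2) Q.rsubmodule_right_module[OF sub(2)]] by auto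
      then have V: "rsubmodule R Q V" "V \<subseteq> N" "simple_rmodule R (Q\<lparr>carrier := V\<rparr>)"
        using rsubmodule_restrict[OF sub(2) Q.right_module_axioms] by auto
      have inj: "injective_rmodule R (Q\<lparr>carrier := V\<rparr>)"
        by (rule right_V_ring_any_type[OF assms(3) V(3)])
      obtain T f where T: "rsubmodule R ?M T"
        "f \<in> rmodule_hom R (?M\<lparr>carrier := T\<rparr>) (Q\<lparr>carrier := V\<rparr>)" "bij_betw f T V"
        by (rule M.simple_submodule_of_quotient[OF J over_socle A B AB nB V(1,3)[unfolded Q_def],
              folded Q_def])
      have "projective_rmodule R (Q\<lparr>carrier := V\<rparr>)"
        by (rule injective_iso_right_ideal_projective[OF inj T(1,2)]) (use T(3) in simp)
      moreover have "direct_summand R (Q\<lparr>carrier := N\<rparr>) V"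
        by (rule Q.injective_direct_summand[OF sub(2) V(1,2) inj])
      ultimately have "V = {\<zero>\<^bsub>Q\<^esub>}" using N unfolding stable_rmodule_def by simp
      then show False using V(3) unfolding Q.simple_restrict_iff[OF V(1)] by blast
    qed
    then have "P <+>\<^bsub>Q\<^esub> N \<subseteq> P"
      using Q.set_add_least[OF sub(1), of P N] rsubmoduleD(2)[OF sub(1)] by simp
    then have "P = carrier Q" using sub(3) rsubmoduleD(1)[OF sub(1)] by simp
    \<comment> \<open>so the quotient map \<open>q\<close> splits, and its kernel \<open>A\<close> is a summand\<close>
    then have "projective_rmodule R Q" using P by simp
    then have "direct_summand R (?M\<lparr>carrier := J\<rparr>) A"
      using kernel_direct_summand_if_projective[OF J.right_module_axioms _ q] qJ ker by simp
    then show False using nA by contradiction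
  qed
  ultimately show ?thesis by blast
qed

end
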